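(* Let $n$ be an odd positive integer, let $x\in\mathbb{R}$ and let $a=(a^0,\dots,a^n)\in\mathbb{R}^{n+1}$. The following statements are equivalent: (1) Problem $\partial CF\mathcal{P}'(\mathbb{R})$ with data $x,a$ has a weak solution; (2) Problem $\partial CF\mathcal{P}'(\mathbb{R})$ with data $x,a$ has a solution which is analytic at $x$; (3) Problem $\partial CF\mathcal{P}'(\mathbb{R})$ with data $x,a$ has a rational solution; (4) Problem $\partial CF\mathcal{P}'(\mathbb{R})$ with data $x,a$ has a real rational solution; (5) Problem $\partial CF\mathcal{P}'(\mathbb{R})$ with data $x,a$ has a nontangential solution; (6) Problem $\partial CF\mathcal{P}'(\mathbb{R})$ with data $x,a$ has a radial solution; (7) the Hankel matrix $H_m(a)$ is positive, where $m=\tfrac12(n+1)$.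
   Context: Let $\Pi=\{z\in\mathbb{C}:\operatorname{Im} z>0\}$. The Pick class $\mathcal{P}$ is the set of analytic functions $f$ on $\Pi$ with $\operatorname{Im} f\ge 0$ on $\Pi$. For $x\in\mathbb{R}$, $z\to x$ nontangentially means that $z\to x$ with $z$ remaining in a set $S\subset\Pi$, with $x$ in the closure of $S$, on which $|z-x|/\operatorname{Im} z$ is bounded (a limit holds nontangentially if it holds along every such $S$). Write $h(z)=o_{\rm nt}((z-x)^n)$ if $h(z)/(z-x)^n\to 0$ as $z\to x$ nontangentially in $\Pi$. Problem $\partial CF\mathcal{P}'(\mathbb{R})$ with data $x\in\mathbb{R}$, $a^0,\dots,a^n\in\mathbb{R}$: find $f\in\mathcal{P}$ such that $f$ is analytic at $x$ (extends analytically to a neighbourhood of $x$), $f^{(k)}(x)/k!=a^k$ for $k=0,1,\dots,n-1$, and $f^{(n)}(x)/n!\le a^n$ (in particular $f^{(n)}(x)$ is real). Such an $f$ is a solution (analytic at $x$). A rational solution is a solution that is a rational function; a real rational solution is one that is a rational function with real coefficients. A function $f\in\mathcal{P}$ is a weak solution of the problem if there is a real number $c\le a^n$ such that $f(z)=a^0+a^1(z-x)+\dots+a^{n-1}(z-x)^{n-1}+c(z-x)^n+o_{\rm nt}((z-x)^n)$. It is a nontangential solution if $f^{(k)}(z)/k!\to a^k$ as $z\to x$ nontangentially in $\Pi$ for $k=0,\dots,n-1$ and $f^{(n)}(z)/n!$ has a nontangential limit at $x$ that is (real and) $\le a^n$. It is a radial solution if $\lim_{y\to0+}f^{(k)}(x+\mathrm{i}y)/k!=a^k$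 for $k=0,\dots,n-1$ and $\lim_{y\to0+}f^{(n)}(x+\mathrm{i}y)/n!$ exists and is (real and) $\le a^n$. $H_m(a)$ is the $m\times m$ Hankel matrix $[a^{i+j-1}]_{i,j=1}^m$ (superscripts are indices). A Hermitian matrix is called positive if it is positive semidefinite. *)

theory Defs
  imports
    "HOL-Complex_Analysis.Complex_Analysis"
    "HOL-Computational_Algebra.Polynomial"
    "Jordan_Normal_Form.Schur_Decomposition"
begin

definition upper_half_plane :: "complex set"
  where "upper_half_plane = {z. Im z > 0}"

text \<open>Only the values on the upper half-plane matter.\<close>

definition pick_class :: "(complex \<Rightarrow> complex) set"
  where "pick_class =
    {f. f holomorphic_on upper_half_plane \<and> (\<forall>z\<in>upper_half_plane. Im (f z) \<ge> 0)}"

definition nt_approach_set :: "real \<Rightarrow> complex set \<Rightarrow> bool"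
  where "nt_approach_set x S \<longleftrightarrow>
    S \<subseteq> upper_half_plane \<and> complex_of_real x \<in> closure S \<and>
    (\<exists>B. \<forall>z\<in>S. cmod (z - of_real x) / Im z \<le> B)"

definition nt_tendsto :: "(complex \<Rightarrow> complex) \<Rightarrow> real \<Rightarrow> complex \<Rightarrow> bool"
  where "nt_tendsto f x l \<longleftrightarrow>
    (\<forall>S. nt_approach_set x S \<longrightarrow> (f \<longlongrightarrow> l) (at (of_real x) within S))"

definition nt_small_o :: "(complex \<Rightarrow> complex) \<Rightarrow> real \<Rightarrow> nat \<Rightarrow> bool"
  where "nt_small_o h x n \<longleftrightarrow> nt_tendsto (\<lambda>z. h z / (z - of_real x) ^ n) x 0"

text \<open>
  In the solution notions below, the data \<open>a\<close> is a sequence of which only the entries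
  \<open>a 0, \<dots>, a n\<close> are used; the problem is posed at the boundary point \<open>x\<close>.
\<close>

text \<open>\<open>g\<close> is an analytic extension of \<open>f\<close> to a neighbourhood of \<open>x\<close>; derivatives of \<open>f\<close> at \<open>x\<close>
  are those of \<open>g\<close>, whose germ at \<open>x\<close> is determined by \<open>f\<close>.\<close>

definition analytic_solution ::
    "nat \<Rightarrow> real \<Rightarrow> (nat \<Rightarrow> real) \<Rightarrow> (complex \<Rightarrow> complex) \<Rightarrow> bool"
  where "analytic_solution n x a f \<longleftrightarrow>
    f \<in> pick_class \<and>
    (\<exists>U g. open U \<and> complex_of_real x \<in> U \<and> g holomorphic_on U \<and>
       (\<forall>z\<in>U \<inter> upper_half_plane. g z = f z) \<and>
       (\<forall>k<n. (deriv ^^ k) g (of_real x) / fact k = of_real (a k)) \<and>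
       (\<exists>c::real. c \<le> a n \<and> (deriv ^^ n) g (of_real x) / fact n = of_real c))"

text \<open>A rational function that is analytic on the upper half-plane has, in lowest terms, a
  denominator without zeros there. This also holds with real coefficients.\<close>

definition rational_on_uhp :: "(complex \<Rightarrow> complex) \<Rightarrow> bool"
  where "rational_on_uhp f \<longleftrightarrow>
    (\<exists>p q :: complex poly. \<forall>z\<in>upper_half_plane.
       poly q z \<noteq> 0 \<and> f z = poly p z / poly q z)"

definition real_rational_on_uhp :: "(complex \<Rightarrow> complex) \<Rightarrow> bool"
  where "real_rational_on_uhp f \<longleftrightarrow>
    (\<exists>p q :: real poly. \<forall>z\<in>upper_half_plane.
       poly (map_poly of_real q) z \<noteq> 0 \<and>
       f z = poly (map_poly of_real p) z / poly (map_poly of_real q) z)"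

definition weak_solution ::
    "nat \<Rightarrow> real \<Rightarrow> (nat \<Rightarrow> real) \<Rightarrow> (complex \<Rightarrow> complex) \<Rightarrow> bool"
  where "weak_solution n x a f \<longleftrightarrow>
    f \<in> pick_class \<and>
    (\<exists>c::real. c \<le> a n \<and>
       nt_small_o (\<lambda>z. f z - ((\<Sum>k<n. of_real (a k) * (z - of_real x) ^ k)
                               + of_real c * (z - of_real x) ^ n)) x n)"

definition nt_solution ::
    "nat \<Rightarrow> real \<Rightarrow> (nat \<Rightarrow> real) \<Rightarrow> (complex \<Rightarrow> complex) \<Rightarrow> bool"
  where "nt_solution n x a f \<longleftrightarrow>
    f \<in> pick_class \<and>
    (\<forall>k<n. nt_tendsto (\<lambda>z. (deriv ^^ k) f z / fact k) x (of_real (a k))) \<and>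
    (\<exists>c::real. c \<le> a n \<and> nt_tendsto (\<lambda>z. (deriv ^^ n) f z / fact n) x (of_real c))"

definition radial_solution ::
    "nat \<Rightarrow> real \<Rightarrow> (nat \<Rightarrow> real) \<Rightarrow> (complex \<Rightarrow> complex) \<Rightarrow> bool"
  where "radial_solution n x a f \<longleftrightarrow>
    f \<in> pick_class \<and>
    (\<forall>k<n. ((\<lambda>y::real. (deriv ^^ k) f (Complex x y) / fact k) \<longlongrightarrow> of_real (a k)) (at_right 0)) \<and>
    (\<exists>c::real. c \<le> a n \<and>
       ((\<lambda>y::real. (deriv ^^ n) f (Complex x y) / fact n) \<longlongrightarrow> of_real c) (at_right 0))"

text \<open>Matrix indices start at 0, so the entry \<open>a\<^sup>i\<^sup>+\<^sup>j\<^sup>-\<^sup>1\<close> for \<open>1 \<le> i, j \<le> m\<close> becomes \<open>a (i + j + 1)\<close>.\<close>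

definition hankel :: "nat \<Rightarrow> (nat \<Rightarrow> real) \<Rightarrow> complex mat"
  where "hankel m a = mat m m (\<lambda>(i, j). of_real (a (i + j + 1)))"

text \<open>The order on \<open>complex\<close> is the one with \<open>0 \<le> z\<close> iff \<open>z\<close> is real and nonnegative.\<close>

definition positive_mat :: "complex mat \<Rightarrow> bool"
  where "positive_mat A \<longleftrightarrow>
    mat_adjoint A = A \<and> (\<forall>v\<in>carrier_vec (dim_row A). 0 \<le> (A *\<^sub>v v) \<bullet>c v)"

end

theory Submission
  imports
    Defs
    "HOL-Computational_Algebra.Fundamental_Theorem_Algebra"
begin

text \<open>
  Positivity is necessary because the Pick kernel \<open>(f z - cnj (f w)) / (z - cnj w)\<close> is positive
  semidefinite, as follows from Cauchy's formula on large discs. Evaluated at the points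
  \<open>x + \<i>y, \<dots>, x + m\<i>y\<close> with weights that extract the first \<open>m\<close> Taylor coefficients, its
  quadratic form tends to the Hankel form as \<open>y\<close> tends to 0; only the expansion of \<open>f\<close> on the
  vertical ray over \<open>x\<close> enters.

  Conversely, Gauss quadrature at the zeros of an orthogonal polynomial turns a positive Hankel
  matrix into a finite measure \<open>\<Sum> w\<^sub>t \<delta>\<^sub>t\<close> with moments \<open>a\<^sup>1, \<dots>, a\<^sup>n\<^sup>-\<^sup>1\<close> and an \<open>n\<close>-th datum
  that is at most \<open>a\<^sup>n\<close>. Then \<open>a\<^sup>0 + \<Sum> w\<^sub>t (z - x) / (1 - t (z - x))\<close> is a real rational solution.
\<close>

text \<open>The bound on the last datum is what makes semidefiniteness the right condition. For
  \<open>a 1 = a 2 = 0\<close> and \<open>a 3 = 1\<close> the Hankel matrix is positive, yet no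
  measure has moments 0, 0, 1. Hence exactness is asked only in degrees below
  \<open>2 * m - 2 = n - 1\<close>, at most \<open>m - 1\<close> nodes suffice, and the last moment
  may drop. Singular matrices are then treated directly, without perturbation or limits. In the
  other direction the true \<open>n\<close>-th coefficient \<open>c\<close> of a solution may lie
  below \<open>a n\<close>; raising it to \<open>a n\<close> changes only the lower right corner of
  the matrix and keeps it positive. The obstacle on the analytic side is that a radial solution is
  controlled on a single line, so boundary derivatives of the kernel in two free variables are out
  of reach. Combinations of kernel values at points of that line replace them, and the order
  \<open>n = 2 * m - 1\<close> of the expansion is just enough to absorb the growth of the weights.
  The moments are shifted by one index against the data because an atom at \<open>t\<close> has the
  Taylor series with \<open>t^j\<close> in degree \<open>j + 1\<close>; \<open>a 0\<close> is free
  and becomes an additive constant.\<close>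

hide_const (open) Module.smult

section \<open>Lagrange interpolation\<close>

text \<open>Stated over any field because it serves twice: for the real nodes of the quadrature and
  for the imaginary directions in which the kernel is sampled.\<close>

definition lagrange_basis :: "'a::field set \<Rightarrow> 'a \<Rightarrow> 'a poly"
  where "lagrange_basis T t =
    smult (inverse (\<Prod>u\<in>T - {t}. t - u)) (\<Prod>u\<in>T - {t}. [:- u, 1:])"

lemma poly_lagrange_basis:
  assumes "finite T" "t \<in> T" "u \<in> T"
  shows "poly (lagrange_basis T t) u = (if u = t then 1 else 0)"
proof (cases "u = t")
  case True
  then show ?thesis
    using assms by (simp add: lagrange_basis_def poly_prod)
next
  case False
  then have "(\<Prod>v\<in>T - {t}. u - v) = 0"
    using assms by (intro prod_zero) auto
  then show ?thesis
    using False by (simp add: lagrange_basis_def poly_prod)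
qed

lemma degree_lagrange_basis:
  assumes "finite T" "t \<in> T"
  shows "degree (lagrange_basis T t) < card T"
proof -
  have "degree (\<Prod>u\<in>T - {t}. [:- u, 1:]) \<le> (\<Sum>u\<in>T - {t}. degree [:- u, 1:])"
    using degree_prod_sum_le[of "T - {t}" "\<lambda>u. [:- u, 1:]"] assms by (simp add: o_def)
  also have "\<dots> = card T - 1"
    using assms by simp
  also have "\<dots> < card T"
    using assms by (metis card_gt_0_iff diff_less empty_iff less_one)
  finally show ?thesis
    unfolding lagrange_basis_def using degree_smult_le le_less_trans by blast
qed

lemma poly_lagrange_interpolation:
  assumes "finite T" "u \<in> T"
  shows "poly (\<Sum>t\<in>T. smult (c t) (lagrange_basis T t)) u = c u"
proof -
  have "poly (\<Sum>t\<in>T. smult (c t) (lagrange_basis T t)) u = (\<Sum>t\<in>T. if u = t then c t else 0)"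
    by (simp add: poly_sum) (rule sum.cong, auto simp: poly_lagrange_basis assms)
  then show ?thesis
    using assms by simp
qed

lemma degree_lagrange_interpolation:
  assumes "finite T" "T \<noteq> {}"
  shows "degree (\<Sum>t\<in>T. smult (c t) (lagrange_basis T t)) < card T"
proof (rule degree_sum_less)
  show "0 < card T"
    using assms by (simp add: card_gt_0_iff)
  show "degree (smult (c t) (lagrange_basis T t)) < card T" if "t \<in> T" for t
    using degree_lagrange_basis[OF assms(1) that] degree_smult_le le_less_trans by blast
qed

text \<open>Otherwise the difference would be a nonzero polynomial of degree below
  \<open>card T\<close> that vanishes on all of \<open>T\<close>.\<close>

lemma lagrange_interpolation:
  assumes "finite T" "degree r < card T"
  shows "(\<Sum>t\<in>T. smult (poly r t) (lagrange_basis T t)) = r" (is "?s = r")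
proof (rule ccontr)
  assume "?s \<noteq> r"
  then have nz: "?s - r \<noteq> 0" by simp
  have "T \<noteq> {}"
    using assms(2) by auto
  then have "degree ?s < card T"
    by (rule degree_lagrange_interpolation[OF assms(1)])
  then have "degree (?s - r) < card T"
    using assms(2) by (rule degree_diff_less)
  moreover have "T \<subseteq> {u. poly (?s - r) u = 0}"
    using poly_lagrange_interpolation[OF assms(1)] by auto
  then have "card T \<le> card {u. poly (?s - r) u = 0}"
    by (intro card_mono poly_roots_finite nz)
  ultimately show False
    using card_poly_roots_bound[OF nz] by linarith
qed

lemma prod_linear_dvd:
  fixes p :: "'a::field poly"
  assumes "finite T" "\<And>t. t \<in> T \<Longrightarrow> poly p t = 0"
  shows "(\<Prod>t\<in>T. [:- t, 1:]) dvd p"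
  using assms
proof (induction T arbitrary: p rule: finite_induct)
  case (insert x T)
  then obtain r where r: "p = [:- x, 1:] * r"
    by (meson insertI1 poly_eq_0_iff_dvd dvdE)
  have "poly r t = 0" if "t \<in> T" for t
    using insert.prems[of t] insert.hyps that r by auto
  then have "(\<Prod>t\<in>T. [:- t, 1:]) dvd r"
    by (rule insert.IH)
  then show ?case
    using insert.hyps r by (simp add: mult_dvd_mono del: mult_pCons_left)
qed simp

section \<open>Orthogonal polynomials and Gauss quadrature\<close>

text \<open>A condition on coefficients rather than on \<open>degree\<close> makes this a linear
  space for every \<open>k\<close>; \<open>polys_below 0\<close> contains just 0, whereas
  \<open>degree q < 0\<close> never holds.\<close>

definition polys_below :: "nat \<Rightarrow> 'a::zero poly set"
  where "polys_below k = {q. \<forall>i\<ge>k. coeff q i = 0}"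

lemma polys_below_iff: "q \<in> polys_below k \<longleftrightarrow> q = 0 \<or> degree q < k"
proof
  assume "q \<in> polys_below k"
  then show "q = 0 \<or> degree q < k"
    unfolding polys_below_def by (metis (mono_tags) leading_coeff_0_iff mem_Collect_eq not_le)
qed (auto simp: polys_below_def coeff_eq_0)

lemma polys_below_diff: "p \<in> polys_below k \<Longrightarrow> q \<in> polys_below k \<Longrightarrow> p - q \<in> polys_below k"
  and polys_below_add: "p \<in> polys_below k \<Longrightarrow> q \<in> polys_below k \<Longrightarrow> p + q \<in> polys_below k"
  and polys_below_smult: "p \<in> polys_below k \<Longrightarrow> smult c p \<in> polys_below k"
  for p q :: "'a::comm_ring poly"
  by (auto simp: polys_below_def)

lemma polys_below_mono: "p \<in> polys_below j \<Longrightarrow> j \<le> k \<Longrightarrow> p \<in> polys_below k"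
  by (auto simp: polys_below_def)

text \<open>The Riesz functional of the sequence \<open>s\<close>: it acts as integration against a
  measure that is still to be found.\<close>

definition moment :: "(nat \<Rightarrow> real) \<Rightarrow> real poly \<Rightarrow> real"
  where "moment s p = (\<Sum>i\<le>degree p. coeff p i * s i)"

lemma moment_eq: "degree p \<le> k \<Longrightarrow> moment s p = (\<Sum>i\<le>k. coeff p i * s i)"
  unfolding moment_def by (rule sum.mono_neutral_left) (auto simp: coeff_eq_0)

lemma moment_0 [simp]: "moment s 0 = 0"
  by (simp add: moment_def)

lemma moment_add: "moment s (p + q) = moment s p + moment s q"
proof -
  define k where "k = max (degree p) (degree q)"
  have "degree (p + q) \<le> k" "degree p \<le> k" "degree q \<le> k"
    by (auto simp: k_def degree_add_le)
  then show ?thesis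
    by (simp add: moment_eq[of _ k] sum.distrib algebra_simps)
qed

lemma moment_smult: "moment s (smult c p) = c * moment s p"
  using moment_eq[of "smult c p" "degree p" s]
  by (simp add: degree_smult_le moment_def sum_distrib_left mult.assoc)

lemma moment_diff: "moment s (p - q) = moment s p - moment s q"
  using moment_add[of s "p - q" q] by simp

lemma moment_sum: "moment s (sum f A) = (\<Sum>i\<in>A. moment s (f i))"
  by (induction A rule: infinite_finite_induct) (auto simp: moment_add)

lemma moment_monom: "moment s (monom c k) = c * s k"
  by (subst moment_eq[of _ k]) (auto simp: degree_monom_le if_distrib[of "\<lambda>x. x * _"] cong: if_cong)

lemmas moment_linear = moment_add moment_diff moment_smult

text \<open>For \<open>p = q\<close> the right-hand side is the Hankel form at the coefficient
  vector, so positivity of the matrix becomes nonnegativity of \<open>moment s\<close> on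
  squares.\<close>

lemma moment_mult:
  assumes "degree p < m" "degree q < m"
  shows "moment s (p * q) = (\<Sum>i<m. \<Sum>j<m. coeff p i * coeff q j * s (i + j))"
proof -
  have *: "r = (\<Sum>i<m. monom (coeff r i) i)" if "degree r < m" for r :: "real poly"
    using poly_as_sum_of_monoms'[of r "m - 1"] that
    by (metis Suc_pred' gr0I lessThan_Suc_atMost less_Suc_eq_le not_less_zero)
  have "p * q = (\<Sum>i<m. \<Sum>j<m. monom (coeff p i * coeff q j) (i + j))"
    by (subst *[OF assms(1)], subst *[OF assms(2)]) (simp add: sum_product mult_monom)
  then show ?thesis
    by (simp add: moment_sum moment_monom)
qed

text \<open>Gram-Schmidt: \<open>monom 1 k\<close> is made orthogonal to the lower degrees, then the
  component of \<open>f\<close> along the result is removed. Definiteness permits the division by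
  \<open>moment s (p * p)\<close>.\<close>

lemma orthogonal_projection:
  assumes "\<And>q. q \<in> polys_below k \<Longrightarrow> q \<noteq> 0 \<Longrightarrow> 0 < moment s (q * q)"
  shows "\<exists>r\<in>polys_below k. \<forall>q\<in>polys_below k. moment s ((f - r) * q) = 0"
  using assms
proof (induction k arbitrary: f)
  case 0
  show ?case
    by (auto simp: polys_below_iff)
next
  case (Suc k)
  have proj: "\<exists>r\<in>polys_below k. \<forall>q\<in>polys_below k. moment s ((g - r) * q) = 0" for g
    by (rule Suc.IH) (use Suc.prems polys_below_mono[of _ k "Suc k"] in auto)
  obtain r0 where r0: "r0 \<in> polys_below k" "\<forall>q\<in>polys_below k. moment s ((monom 1 k - r0) * q) = 0"
    using proj by blast
  obtain r where r: "r \<in> polys_below k" "\<forall>q\<in>polys_below k. moment s ((f - r) * q) = 0"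
    using proj by blast
  define p where "p = monom 1 k - r0"
  have pk: "coeff p k = 1" and pS: "p \<in> polys_below (Suc k)"
    using r0(1) by (auto simp: p_def polys_below_def)
  have pp: "moment s (p * p) > 0"
    using Suc.prems[OF pS] pk by fastforce
  define t where "t = moment s ((f - r) * p) / moment s (p * p)"
  have "moment s ((f - (r + smult t p)) * q) = 0" if q: "q \<in> polys_below (Suc k)" for q
  proof -
    \<comment> \<open>Since \<open>p\<close> is monic of degree \<open>k\<close>, this cancels the
      top coefficient of \<open>q\<close>, and both orthogonality relations apply to
      \<open>q'\<close>.\<close>
    define q' where "q' = q - smult (coeff q k) p"
    have q': "q' \<in> polys_below k"
      unfolding polys_below_def
    proof (intro CollectI allI impI)
      fix i assume "k \<le> i"
      then consider "i = k" | "Suc k \<le> i" by linarith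
      then show "coeff q' i = 0"
        by cases (use q pS pk in \<open>simp_all add: q'_def polys_below_def\<close>)
    qed
    have "(f - (r + smult t p)) * q = smult (coeff q k) ((f - r) * p) - smult (coeff q k * t) (p * p)
        + (f - r) * q' - smult t (p * q')"
      by (simp add: q'_def algebra_simps smult_diff_right)
    then have "moment s ((f - (r + smult t p)) * q) =
        coeff q k * moment s ((f - r) * p) - coeff q k * t * moment s (p * p)
        + moment s ((f - r) * q') - t * moment s (p * q')"
      by (simp only: moment_linear)
    moreover have "moment s ((f - r) * q') = 0" "moment s (p * q') = 0"
      using q' r(2) r0(2) by (auto simp: p_def)
    ultimately show ?thesis
      using pp by (simp add: t_def)
  qed
  moreover have "r + smult t p \<in> polys_below (Suc k)"
    using r(1) pS polys_below_mono[of r k "Suc k"] by (auto intro!: polys_below_add polys_below_smult)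
  ultimately show ?case by blast
qed

text \<open>Cauchy-Schwarz in the degenerate case: as \<open>moment s (p * p) = 0\<close>, the
  moment of \<open>(r + t p)^2\<close> is affine in \<open>t\<close>, and an affine function that is
  nowhere negative has slope 0.\<close>

lemma moment_square_zero:
  assumes psd: "\<And>q. degree q < m \<Longrightarrow> 0 \<le> moment s (q * q)"
    and "degree p < m" "moment s (p * p) = 0" "degree r < m"
  shows "moment s (p * r) = 0"
proof (rule ccontr)
  assume nz: "moment s (p * r) \<noteq> 0"
  \<comment> \<open>The value of \<open>t\<close> at which the affine function equals -1.\<close>
  define t where "t = - (moment s (r * r) + 1) / (2 * moment s (p * r))"
  have "degree (r + smult t p) < m"
    using assms by (intro degree_add_less) (auto intro: le_less_trans[OF degree_smult_le])
  then have "0 \<le> moment s ((r + smult t p) * (r + smult t p))"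
    by (rule psd)
  also have "(r + smult t p) * (r + smult t p) = r * r + smult (2 * t) (p * r) + smult (t * t) (p * p)"
  proof -
    have "smult (2 * t) (p * r) = smult t (p * r) + smult t (p * r)"
      by (simp add: smult_add_left[symmetric])
    then show ?thesis
      by (simp add: algebra_simps)
  qed
  also have "moment s \<dots> = moment s (r * r) + 2 * t * moment s (p * r)"
    using assms(3) by (simp add: moment_linear)
  also have "2 * t * moment s (p * r) = - (moment s (r * r) + 1)"
    using nz by (simp add: t_def)
  finally show False by simp
qed

lemma moment_mult_zero_of_monom:
  assumes "\<And>i. i < k \<Longrightarrow> moment s (p * monom 1 i) = 0" "r \<in> polys_below k"
  shows "moment s (p * r) = 0"
proof (cases "r = 0")
  case False
  with assms(2) have deg: "degree r < k" by (simp add: polys_below_iff)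
  have "p * r = (\<Sum>i\<le>degree r. smult (coeff r i) (p * monom 1 i))"
    by (subst (1) poly_as_sum_of_monoms[of r, symmetric])
      (simp add: sum_distrib_left mult_smult_right[symmetric] smult_monom del: mult_smult_right)
  then have "moment s (p * r) = (\<Sum>i\<le>degree r. coeff r i * moment s (p * monom 1 i))"
    by (simp add: moment_sum moment_smult)
  then show ?thesis
    using assms(1) deg by simp
qed simp

text \<open>
  If the form degenerates below degree \<open>m - 1\<close>, take for \<open>p\<close> a null vector of least degree. By
  Cauchy--Schwarz its multiples \<open>t\<^sup>i p\<close> of degree below \<open>m - 1\<close> lie in the kernel too, and they supply
  the orthogonality in the high degrees.
\<close>

lemma exists_orthogonal_poly:
  assumes psd: "\<And>q. degree q < m \<Longrightarrow> 0 \<le> moment s (q * q)" and "0 < m"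
  obtains p where "degree p < m" "lead_coeff p = 1"
    "\<And>q. q \<in> polys_below (degree p) \<Longrightarrow> q \<noteq> 0 \<Longrightarrow> 0 < moment s (q * q)"
    "\<And>r. r \<in> polys_below (2 * m - 2 - degree p) \<Longrightarrow> moment s (p * r) = 0"
proof -
  define posdef where "posdef k \<longleftrightarrow> (\<forall>q\<in>polys_below k. q \<noteq> 0 \<longrightarrow> 0 < moment s (q * q))" for k
  \<comment> \<open>The cap at \<open>m - 1\<close> holds even if the form is definite in all
    degrees below \<open>m\<close>; it guarantees \<open>degree p < m\<close> and separates the two
    cases.\<close>
  define k where "k = Greatest (\<lambda>k. k \<le> m - 1 \<and> posdef k)"
  have 0: "0 \<le> m - 1 \<and> posdef 0"
    by (auto simp: posdef_def polys_below_iff)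
  have k: "k \<le> m - 1" "posdef k"
    using GreatestI_nat[of "\<lambda>k. k \<le> m - 1 \<and> posdef k", OF 0, of "m - 1"] by (auto simp: k_def)
  show ?thesis
  proof (cases "k = m - 1")
    case True
    obtain r0 where r0: "r0 \<in> polys_below k" "\<forall>q\<in>polys_below k. moment s ((monom 1 k - r0) * q) = 0"
      using orthogonal_projection[of k s "monom 1 k"] k(2) unfolding posdef_def by blast
    define p where "p = monom 1 k - r0"
    have ck: "coeff p k = 1" and "p \<in> polys_below (Suc k)"
      using r0(1) by (auto simp: p_def polys_below_def)
    then have "p \<noteq> 0" "degree p \<le> k"
      by (auto simp: polys_below_iff)
    then have deg: "degree p = k"
      using ck le_degree[of p k] by simp
    show ?thesis
    proof (rule that[of p])
      show "moment s (p * r) = 0" if "r \<in> polys_below (2 * m - 2 - degree p)" for r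
      proof -
        have "2 * m - 2 - degree p = k"
          using True deg \<open>0 < m\<close> by simp
        then show ?thesis
          using that r0(2) by (simp add: p_def)
      qed
    qed (use deg ck k \<open>0 < m\<close> in \<open>auto simp: posdef_def\<close>)
  next
    case False
    have "\<not> posdef (Suc k)"
    proof
      assume "posdef (Suc k)"
      then have "Suc k \<le> k"
        unfolding k_def using False k
        by (intro Greatest_le_nat[of _ _ "m - 1"]) (auto simp: k_def)
      then show False by simp
    qed
    then obtain q where q: "q \<in> polys_below (Suc k)" "q \<noteq> 0" "\<not> 0 < moment s (q * q)"
      by (auto simp: posdef_def)
    have "q \<notin> polys_below k"
      using q k(2) by (auto simp: posdef_def)
    then have degq: "degree q = k"
      using q by (auto simp: polys_below_iff)
    have qq: "moment s (q * q) = 0"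
      using psd[of q] q(3) degq k(1) \<open>0 < m\<close> by linarith
    define p where "p = smult (inverse (lead_coeff q)) q"
    have deg: "degree p = k" and lead: "lead_coeff p = 1"
      using q(2) degq by (auto simp: p_def)
    have pp: "moment s (p * p) = 0"
      by (simp add: p_def moment_smult qq)
    have degp: "degree (monom 1 i * p) \<le> i + k" for i
      using degree_mult_le[of "monom 1 i" p] degree_monom_le[of "1::real" i] deg by linarith
    have kernel: "degree r < m \<Longrightarrow> moment s (monom 1 i * p * r) = 0" if "i + k \<le> m - 2" for i r
      using that
    proof (induction i arbitrary: r)
      case 0
      then show ?case
        using moment_square_zero[where p = p and r = r and m = m and s = s] psd pp deg k(1) \<open>0 < m\<close>
        by (simp add: monom_0)
    next
      case (Suc i)
      \<comment> \<open>The square of \<open>t^(i+1) p\<close> is regrouped as \<open>t^i p\<close>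
        times \<open>t^(i+2) p\<close>. The bound \<open>m - 2\<close> on \<open>Suc i + k\<close>
        keeps the second factor below degree \<open>m\<close>, so the induction hypothesis makes the
        square vanish.\<close>
      have "monom 1 (Suc i) * p * (monom 1 (Suc i) * p) = monom 1 i * p * (monom 1 (Suc (Suc i)) * p)"
        by (simp add: algebra_simps mult_monom[symmetric] monom_Suc)
      moreover have "degree (monom 1 (Suc (Suc i)) * p) < m"
        using degp[of "Suc (Suc i)"] Suc.prems by linarith
      ultimately have "moment s (monom 1 (Suc i) * p * (monom 1 (Suc i) * p)) = 0"
        using Suc.IH[of "monom 1 (Suc (Suc i)) * p"] Suc.prems by (metis Suc_leD add_Suc)
      moreover have "degree (monom 1 (Suc i) * p) < m"
        using degp[of "Suc i"] Suc.prems by linarith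
      ultimately show ?case
        using moment_square_zero[where p = "monom 1 (Suc i) * p" and r = r and m = m and s = s]
          psd Suc.prems by simp
    qed
    show ?thesis
    proof (rule that[of p])
      fix r :: "real poly"
      assume r: "r \<in> polys_below (2 * m - 2 - degree p)"
      show "moment s (p * r) = 0"
      proof (rule moment_mult_zero_of_monom[OF _ r])
        fix l assume l: "l < 2 * m - 2 - degree p"
        \<comment> \<open>As many factors \<open>t\<close> as the kernel claim allows go to
          \<open>p\<close>; what remains of \<open>t^l\<close> then has degree below
          \<open>m\<close>.\<close>
        define i where "i = min l (m - 2 - k)"
        have i: "i + k \<le> m - 2" "i \<le> l" "l - i < m"
          using l deg False k \<open>0 < m\<close> by (auto simp: i_def min_def)
        have "degree (monom (1::real) (l - i)) < m"
          using i(3) degree_monom_le le_less_trans by blast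
        then have "moment s (monom 1 i * p * monom 1 (l - i)) = 0"
          by (rule kernel[OF i(1)])
        also have "monom 1 i * p * monom 1 (l - i) = p * monom 1 l"
          using i(2) by (simp add: mult.commute[of _ p] mult.assoc mult_monom)
        finally show "moment s (p * monom 1 l) = 0" .
      qed
    qed (use deg lead k \<open>0 < m\<close> in \<open>auto simp: posdef_def\<close>)
  qed
qed

section \<open>Complex roots of real polynomials\<close>

lemma map_poly_of_real_add:
  "map_poly complex_of_real (p + q) = map_poly of_real p + map_poly of_real q"
  by (rule poly_eqI) (simp add: coeff_map_poly)

lemma map_poly_of_real_mult:
  "map_poly complex_of_real (p * q) = map_poly of_real p * map_poly of_real q"
  by (rule poly_eqI) (simp add: coeff_map_poly coeff_mult)

lemma poly_map_of_real_pCons: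
  "poly (map_poly complex_of_real (pCons c p)) z = of_real c + z * poly (map_poly of_real p) z"
proof -
  have "map_poly complex_of_real (pCons c p) = pCons (of_real c) (map_poly of_real p)"
    by (rule poly_eqI) (simp add: coeff_map_poly coeff_pCons split: nat.split)
  then show ?thesis
    by simp
qed

lemma of_real_poly_map_eval: "poly (map_poly of_real p) (complex_of_real t) = of_real (poly p t)"
  by (induction p) (simp_all add: poly_map_of_real_pCons)

text \<open>The quadratic is the real minimal polynomial of \<open>Complex u v\<close>. The
  remainder modulo it is real of degree at most 1, and such a polynomial vanishes at a nonreal point
  only if it is 0.\<close>

lemma quadratic_dvd_of_complex_root:
  fixes r :: "real poly"
  assumes "poly (map_poly of_real r) (Complex u v) = 0" "v \<noteq> 0"
  shows "[:u\<^sup>2 + v\<^sup>2, - 2 * u, 1:] dvd r"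
proof -
  define e where "e = [:u\<^sup>2 + v\<^sup>2, - 2 * u, 1:]"
  define d where "d = r mod e"
  have "e \<noteq> 0" "degree e = 2"
    by (auto simp: e_def)
  then have deg: "degree d \<le> 1"
    using degree_mod_less[of e r] by (auto simp: d_def)
  have "poly (map_poly of_real e) (Complex u v) = 0"
    by (simp add: e_def poly_map_of_real_pCons complex_eq_iff power2_eq_square algebra_simps)
  then have "poly (map_poly of_real d) (Complex u v) = 0"
    using assms(1) arg_cong[OF div_mult_mod_eq[of r e], of "\<lambda>q. poly (map_poly of_real q) (Complex u v)"]
    unfolding map_poly_of_real_add map_poly_of_real_mult d_def by simp
  moreover have "d = [:coeff d 0, coeff d 1:]"
    using deg by (intro poly_eqI) (auto simp: coeff_pCons coeff_eq_0 split: nat.split)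
  ultimately have "poly (map_poly of_real [:coeff d 0, coeff d 1:]) (Complex u v) = 0"
    by simp
  then have "coeff d 1 = 0 \<and> coeff d 0 = 0"
    using assms(2) by (auto simp: poly_map_of_real_pCons complex_eq_iff)
  then have "d = 0"
    using \<open>d = [:coeff d 0, coeff d 1:]\<close> by simp
  then show ?thesis
    by (simp add: d_def e_def mod_eq_0_iff_dvd)
qed

text \<open>A repeated root gives \<open>p = (t - u)\<^sup>2 q\<close> and a nonreal one \<open>p = ((t - u)\<^sup>2 + v\<^sup>2) q\<close>; in both cases the
  moment of \<open>p q\<close> is a sum of moments of squares, hence positive, against orthogonality.\<close>

lemma orthogonal_poly_splits:
  assumes monic: "lead_coeff p = 1"
    and pos: "\<And>q. q \<in> polys_below (degree p) \<Longrightarrow> q \<noteq> 0 \<Longrightarrow> 0 < moment s (q * q)"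
    and orth: "\<And>r. r \<in> polys_below (degree p) \<Longrightarrow> moment s (p * r) = 0"
  obtains T where "finite T" "card T = degree p" "p = (\<Prod>t\<in>T. [:- t, 1:])"
proof -
  define T where "T = {t. poly p t = 0}"
  have p0: "p \<noteq> 0"
    using monic by auto
  then have fin: "finite T"
    by (simp add: T_def poly_roots_finite)
  define d where "d = (\<Prod>t\<in>T. [:- t, 1:])"
  have "d dvd p"
    unfolding d_def by (rule prod_linear_dvd[OF fin]) (simp add: T_def)
  then obtain r where r: "p = d * r" by (rule dvdE)
  have simple: False if "p = [:- t, 1:] * ([:- t, 1:] * q)" for t q
  proof -
    have q0: "q \<noteq> 0"
      using that p0 by auto
    have "degree ([:- t, 1:] * q) = Suc (degree q)" "degree p = Suc (Suc (degree q))"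
      unfolding that using q0 by (simp_all add: degree_mult_eq del: mult_pCons_left)
    then have "q \<in> polys_below (degree p)" "[:- t, 1:] * q \<in> polys_below (degree p)"
      by (auto simp: polys_below_iff simp del: mult_pCons_left)
    moreover have "[:- t, 1:] * q \<noteq> 0"
      using q0 by (simp del: mult_pCons_left)
    ultimately have "0 < moment s ([:- t, 1:] * q * ([:- t, 1:] * q))" "moment s (p * q) = 0"
      using pos orth by blast+
    moreover have "p * q = [:- t, 1:] * q * ([:- t, 1:] * q)"
      by (subst that) (simp only: ac_simps)
    ultimately show False by simp
  qed
  have nonreal: False if "p = [:u\<^sup>2 + v\<^sup>2, - 2 * u, 1:] * q" for u v q
  proof -
    have q0: "q \<noteq> 0"
      using that p0 by auto
    have "degree ([:- u, 1:] * q) = Suc (degree q)" "degree p = Suc (Suc (degree q))"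
      unfolding that using q0 by (simp_all add: degree_mult_eq del: mult_pCons_left)
    then have "q \<in> polys_below (degree p)" "[:- u, 1:] * q \<in> polys_below (degree p)"
      by (auto simp: polys_below_iff simp del: mult_pCons_left)
    moreover have "[:- u, 1:] * q \<noteq> 0"
      using q0 by (simp del: mult_pCons_left)
    ultimately have signs: "0 < moment s ([:- u, 1:] * q * ([:- u, 1:] * q))" "0 < moment s (q * q)"
        "moment s (p * q) = 0"
      using pos orth q0 by blast+
    have "[:u\<^sup>2 + v\<^sup>2, - 2 * u, 1:] = [:- u, 1:] * [:- u, 1:] + [:v\<^sup>2:]"
      by (simp add: power2_eq_square)
    then have "p * q = [:- u, 1:] * q * ([:- u, 1:] * q) + [:v\<^sup>2:] * (q * q)"
      unfolding that by (simp only: distrib_left distrib_right ac_simps)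
    moreover have "[:v\<^sup>2:] * (q * q) = smult (v\<^sup>2) (q * q)"
      by simp
    ultimately have "moment s (p * q) = moment s ([:- u, 1:] * q * ([:- u, 1:] * q)) + v\<^sup>2 * moment s (q * q)"
      by (simp only: moment_linear)
    moreover have "0 \<le> v\<^sup>2 * moment s (q * q)"
      using signs(2) by simp
    ultimately show False
      using signs by linarith
  qed
  \<comment> \<open>A nonconstant cofactor has a complex root. If real, it is already in
    \<open>T\<close> and so a repeated root of \<open>p\<close>; if nonreal, it brings in a
    quadratic factor. Both are excluded above.\<close>
  have "degree r = 0"
  proof (rule ccontr)
    assume "degree r \<noteq> 0"
    then have "\<not> constant (poly (map_poly complex_of_real r))"
      by (simp add: constant_degree degree_map_poly)
    then obtain z where z: "poly (map_poly complex_of_real r) z = 0"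
      using fundamental_theorem_of_algebra by blast
    show False
    proof (cases "Im z = 0")
      case True
      then have "z = of_real (Re z)"
        by (simp add: complex_eq_iff)
      then have "complex_of_real (poly r (Re z)) = 0"
        using z by (metis of_real_poly_map_eval)
      then have "poly r (Re z) = 0" by simp
      then obtain q where q: "r = [:- Re z, 1:] * q"
        by (meson poly_eq_0_iff_dvd dvdE)
      have "Re z \<in> T"
        using q r by (simp add: T_def)
      then have "[:- Re z, 1:] dvd d"
        unfolding d_def by (intro dvd_prodI fin)
      then obtain q' where "d = [:- Re z, 1:] * q'" by (rule dvdE)
      then have "p = [:- Re z, 1:] * ([:- Re z, 1:] * (q' * q))"
        by (simp only: r q ac_simps)
      then show False by (rule simple)
    next
      case False
      then have "[:(Re z)\<^sup>2 + (Im z)\<^sup>2, - 2 * Re z, 1:] dvd p"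
        using quadratic_dvd_of_complex_root[of r "Re z" "Im z"] z r by (auto intro: dvd_mult)
      then show False
        using nonreal by (meson dvdE)
    qed
  qed
  moreover have "lead_coeff d = 1"
    by (simp add: d_def lead_coeff_prod)
  then have "lead_coeff r = 1"
    using monic by (simp add: r lead_coeff_mult)
  ultimately have "r = 1"
    by (metis lead_coeff_pCons(2) degree_eq_zeroE one_pCons coeff_pCons_0)
  then have "p = d"
    using r by simp
  moreover have "degree d = card T"
    using fin by (simp add: d_def degree_prod_eq_sum_degree)
  ultimately show ?thesis
    using that[of T] fin by (simp add: d_def)
qed

text \<open>Subtracting from \<open>r\<close> its interpolant at the zeros of \<open>p\<close>
  leaves a multiple \<open>p * g\<close>, with \<open>g\<close> of low enough degree for
  orthogonality to remove it. This gives exactness in about twice as many degrees as interpolation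
  alone would when the number of nodes is \<open>m - 1\<close>.\<close>

lemma gauss_quadrature:
  assumes psd: "\<And>q. degree q < m \<Longrightarrow> 0 \<le> moment s (q * q)" and "0 < m"
  obtains T w where "finite T" "\<And>t. t \<in> T \<Longrightarrow> 0 \<le> w t"
    "\<And>j. j < 2 * m - 2 \<Longrightarrow> s j = (\<Sum>t\<in>T. w t * t ^ j)"
    "(\<Sum>t\<in>T. w t * t ^ (2 * m - 2)) \<le> s (2 * m - 2)"
proof -
  obtain p where p: "degree p < m" "lead_coeff p = 1"
    "\<And>q. q \<in> polys_below (degree p) \<Longrightarrow> q \<noteq> 0 \<Longrightarrow> 0 < moment s (q * q)"
    "\<And>r. r \<in> polys_below (2 * m - 2 - degree p) \<Longrightarrow> moment s (p * r) = 0"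
    using exists_orthogonal_poly[OF assms] by blast
  have "moment s (p * r) = 0" if "r \<in> polys_below (degree p)" for r
    using p(4) polys_below_mono[OF that] p(1) by simp
  then obtain T where T: "finite T" "card T = degree p" "p = (\<Prod>t\<in>T. [:- t, 1:])"
    using orthogonal_poly_splits[OF p(2,3)] by blast
  have poly_p: "poly p t = 0" if "t \<in> T" for t
    using T that by (auto simp: poly_prod)
  define w where "w t = moment s (lagrange_basis T t)" for t
  have quad: "moment s r = (\<Sum>t\<in>T. w t * poly r t)" if r: "r \<in> polys_below (2 * m - 2)" for r
  proof -
    define l where "l = (\<Sum>t\<in>T. smult (poly r t) (lagrange_basis T t))"
    have "p dvd r - l"
      unfolding T(3) by (rule prod_linear_dvd[OF T(1)]) (simp add: l_def poly_lagrange_interpolation T(1))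
    then obtain g where g: "r - l = p * g" by (rule dvdE)
    have "moment s (p * g) = 0"
    proof (cases "g = 0 \<or> T = {}")
      case True
      then show ?thesis
      proof
        \<comment> \<open>Without nodes \<open>p = 1\<close>, and orthogonality says that
          \<open>moment s\<close> vanishes on all of \<open>polys_below (2 * m - 2)\<close>.\<close>
        assume "T = {}"
        then have "p = 1" "l = 0"
          using T(3) by (simp_all add: l_def)
        then show ?thesis
          using p(4)[of g] r g by simp
      qed simp
    next
      case False
      have "l \<in> polys_below (degree p)"
        using degree_lagrange_interpolation[OF T(1)] False T(2) by (simp add: l_def polys_below_iff)
      then have "l \<in> polys_below (2 * m - 2)"
        using p(1) False T by (auto intro: polys_below_mono)
      then have "p * g \<in> polys_below (2 * m - 2)"
        using polys_below_diff[OF r] g by metis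
      moreover have "p \<noteq> 0"
        using p(2) by auto
      ultimately have "degree p + degree g < 2 * m - 2"
        using False by (auto simp: polys_below_iff degree_mult_eq)
      then show ?thesis
        by (intro p(4)) (auto simp: polys_below_iff)
    qed
    then have "moment s r = moment s l"
      using g moment_diff[of s r l] by simp
    also have "\<dots> = (\<Sum>t\<in>T. w t * poly r t)"
      by (simp add: l_def moment_sum moment_smult w_def mult.commute)
    finally show ?thesis .
  qed
  show ?thesis
  proof (rule that[of T w])
    show "0 \<le> w t" if t: "t \<in> T" for t
    proof -
      \<comment> \<open>The square of a basis polynomial is still within the range of exactness and
        picks out its own weight, which is therefore the moment of a square.\<close>
      let ?l = "lagrange_basis T t"
      have deg: "degree ?l < degree p"
        using degree_lagrange_basis[OF T(1) t] T(2) by simp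
      then have "?l * ?l \<in> polys_below (2 * m - 2)"
        using degree_mult_le[of ?l ?l] p(1) by (auto simp: polys_below_iff)
      then have "moment s (?l * ?l) = (\<Sum>u\<in>T. w u * poly (?l * ?l) u)"
        by (rule quad)
      also have "\<dots> = (\<Sum>u\<in>T. if u = t then w t else 0)"
        by (rule sum.cong) (use t in \<open>auto simp: poly_lagrange_basis T(1)\<close>)
      also have "\<dots> = w t"
        using T(1) t by simp
      finally show ?thesis
        using psd[of ?l] deg p(1) by simp
    qed
    show "s j = (\<Sum>t\<in>T. w t * t ^ j)" if "j < 2 * m - 2" for j
      using quad[of "monom 1 j"] that by (simp add: moment_monom poly_monom polys_below_def)
    \<comment> \<open>\<open>e\<^sup>2\<close> vanishes at all nodes, so the defect of the quadrature in degree \<open>2 m - 2\<close> is its moment.\<close>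
    define e where "e = monom 1 (m - 1 - degree p) * p"
    have "p \<noteq> 0"
      using p(2) by auto
    then have e: "degree e = m - 1"
      using p(1) by (simp add: e_def degree_mult_eq degree_monom_eq monom_eq_0_iff)
    have "lead_coeff e = 1"
      by (simp only: e_def lead_coeff_mult p(2) lead_coeff_monom mult_1)
    moreover from this have "e \<noteq> 0"
      by auto
    ultimately have deg2: "degree (e * e) = 2 * m - 2" and "lead_coeff (e * e) = 1"
      using e by (simp add: degree_mult_eq, metis lead_coeff_mult mult_1)
    \<comment> \<open>Both terms are monic of degree \<open>2 * m - 2\<close>, so their difference
      falls just inside the range of exactness.\<close>
    then have "monom 1 (2 * m - 2) - e * e \<in> polys_below (2 * m - 2)"
      unfolding deg2[symmetric] by (auto simp: polys_below_def le_less coeff_eq_0)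
    then have "moment s (monom 1 (2 * m - 2) - e * e) = (\<Sum>t\<in>T. w t * poly (monom 1 (2 * m - 2) - e * e) t)"
      by (rule quad)
    also have "\<dots> = (\<Sum>t\<in>T. w t * t ^ (2 * m - 2))"
      by (rule sum.cong) (auto simp: e_def poly_p poly_monom)
    also have "moment s (monom 1 (2 * m - 2) - e * e) = s (2 * m - 2) - moment s (e * e)"
      by (simp add: moment_diff moment_monom)
    finally show "(\<Sum>t\<in>T. w t * t ^ (2 * m - 2)) \<le> s (2 * m - 2)"
      using psd[of e] e \<open>0 < m\<close> by simp
  qed (rule T(1))
qed

section \<open>Positivity of the Pick kernel\<close>

text \<open>On the circle \<open>dz\<close> is \<open>\<i> (z - c) dt\<close>, so the imaginary part
  of the contour integral is the ordinary integral of \<open>Re ((z - c) * f z)\<close>.\<close>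

lemma Im_circle_integral_nonneg:
  assumes "(f has_contour_integral I) (circlepath c r)" "0 < r"
    and nonneg: "\<And>z. z \<in> sphere c r \<Longrightarrow> 0 \<le> Re ((z - c) * f z)"
  shows "0 \<le> Im I"
proof -
  have "((\<lambda>t. f (c + r * cis t) * r * \<i> * cis t) has_integral I) {0..2 * pi}"
    using assms(1) unfolding circlepath_def
    by (subst (asm) has_contour_integral_part_circlepath_iff) auto
  then have "((\<lambda>t. Im (f (c + r * cis t) * r * \<i> * cis t)) has_integral Im I) {0..2 * pi}"
    by (rule has_integral_Im)
  then show ?thesis
  proof (rule has_integral_nonneg)
    fix t :: real
    have "c + r * cis t \<in> sphere c r"
      using assms(2) by (simp add: dist_norm norm_mult)
    then have "0 \<le> Re ((r * cis t) * f (c + r * cis t))"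
      using nonneg by fastforce
    then show "0 \<le> Im (f (c + r * cis t) * r * \<i> * cis t)"
      by (simp add: algebra_simps)
  qed
qed

text \<open>On the circle, \<open>(u - c) / (u - z k)\<close> is \<open>r\<^sup>2\<close> times the conjugate of \<open>1 / d k u\<close>. So the integrand is
  \<open>h\<close> times a squared modulus, while Cauchy's formula evaluates the integral to the kernel form.\<close>

lemma disc_kernel_nonneg:
  fixes h :: "complex \<Rightarrow> complex"
  assumes hol: "h holomorphic_on cball c r" and "0 < r"
    and nonneg: "\<And>u. u \<in> cball c r \<Longrightarrow> 0 \<le> Re (h u)"
    and J: "finite J" "\<And>j. j \<in> J \<Longrightarrow> cmod (z j - c) < r"
  shows "0 \<le> Re (\<Sum>j\<in>J. \<Sum>k\<in>J. cnj (b j) * b k * (h (z k) / (of_real (r\<^sup>2) - cnj (z j - c) * (z k - c))))"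
    (is "0 \<le> Re ?S")
proof -
  define d where "d j u = of_real (r\<^sup>2) - cnj (z j - c) * (u - c)" for j u
  define f where "f u = (\<Sum>j\<in>J. \<Sum>k\<in>J. cnj (b j) * b k * ((h u / d j u) / (u - z k)))" for u
  have d0: "d j u \<noteq> 0" if "j \<in> J" "u \<in> cball c r" for j u
  proof
    assume "d j u = 0"
    then have "cnj (z j - c) * (u - c) = of_real (r\<^sup>2)"
      by (simp add: d_def)
    then have "cmod (cnj (z j - c) * (u - c)) = cmod (of_real (r\<^sup>2))"
      by (rule arg_cong)
    then have "cmod (z j - c) * cmod (u - c) = r * r"
      by (simp only: norm_mult complex_mod_cnj norm_of_real) (simp add: power2_eq_square)
    moreover have "cmod (z j - c) * cmod (u - c) < r * r"
    proof -
      have "cmod (z j - c) * cmod (u - c) \<le> cmod (z j - c) * r"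
        using that(2) by (intro mult_left_mono) (auto simp: dist_norm norm_minus_commute)
      also have "\<dots> < r * r"
        using J(2)[OF that(1)] \<open>0 < r\<close> by simp
      finally show ?thesis .
    qed
    ultimately show False by simp
  qed
  have "((\<lambda>u. (h u / d j u) / (u - z k)) has_contour_integral (2 * of_real pi * \<i> * (h (z k) / d j (z k))))
      (circlepath c r)" if "j \<in> J" "k \<in> J" for j k
  proof (rule Cauchy_integral_circlepath_simple)
    have "d j holomorphic_on cball c r"
      unfolding d_def by (intro holomorphic_intros)
    then show "(\<lambda>u. h u / d j u) holomorphic_on cball c r"
      using hol d0[OF that(1)] by (intro holomorphic_intros) auto
  qed (use J that in auto)
  then have "(f has_contour_integral (\<Sum>j\<in>J. \<Sum>k\<in>J. cnj (b j) * b k * (2 * of_real pi * \<i> * (h (z k) / d j (z k)))))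
      (circlepath c r)"
    unfolding f_def by (intro has_contour_integral_sum has_contour_integral_lmul J)
  also have "(\<Sum>j\<in>J. \<Sum>k\<in>J. cnj (b j) * b k * (2 * of_real pi * \<i> * (h (z k) / d j (z k)))) = 2 * of_real pi * \<i> * ?S"
    by (simp add: sum_distrib_left d_def mult_ac)
  finally have "0 \<le> Im (2 * of_real pi * \<i> * ?S)"
  proof (rule Im_circle_integral_nonneg[OF _ \<open>0 < r\<close>])
    fix u assume u: "u \<in> sphere c r"
    define g where "g = (\<Sum>j\<in>J. cnj (b j) / d j u)"
    have r2: "complex_of_real (r\<^sup>2) = (u - c) * cnj (u - c)"
      using u unfolding complex_norm_square[symmetric] by (simp add: dist_norm norm_minus_commute)
    have "u - c \<noteq> 0"
      using u \<open>0 < r\<close> by auto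
    have *: "(u - c) / (u - z k) = of_real (r\<^sup>2) / cnj (d k u)" if "k \<in> J" for k
    proof -
      have "cnj (d k u) = of_real (r\<^sup>2) - (z k - c) * cnj (u - c)"
        by (simp add: d_def)
      also have "\<dots> = cnj (u - c) * (u - z k)"
        unfolding r2 by (simp add: algebra_simps)
      finally have eq: "cnj (d k u) = cnj (u - c) * (u - z k)" .
      show ?thesis
        unfolding eq r2 using \<open>u - c \<noteq> 0\<close> by (simp add: complex_cnj_diff[symmetric] del: complex_cnj_diff)
    qed
    have "(u - c) * f u = (\<Sum>j\<in>J. \<Sum>k\<in>J. h u * (cnj (b j) / d j u) * (b k * ((u - c) / (u - z k))))"
      unfolding f_def by (simp add: sum_distrib_left mult_ac)
    also have "\<dots> = (\<Sum>j\<in>J. \<Sum>k\<in>J. of_real (r\<^sup>2) * h u * (cnj (b j) / d j u) * cnj (cnj (b k) / d k u))"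
      by (intro sum.cong refl) (simp add: *)
    also have "\<dots> = of_real (r\<^sup>2) * h u * (g * cnj g)"
      by (simp add: g_def sum_product sum_distrib_left mult_ac)
    also have "\<dots> = of_real (r\<^sup>2 * (cmod g)\<^sup>2) * h u"
      by (simp add: complex_norm_square[symmetric] mult_ac)
    finally show "0 \<le> Re ((u - c) * f u)"
      using nonneg[of u] u by simp
  qed
  then have "0 \<le> 2 * pi * Re ?S"
    by (simp del: Re_sum)
  then show ?thesis
    using pi_gt_zero by (auto simp: zero_le_mult_iff simp del: Re_sum)
qed

text \<open>For the disc with centre \<open>\<i>R\<close> and squared radius \<open>R\<^sup>2 - 1\<close> the denominators of the disc kernel, divided
  by \<open>R\<close>, tend to \<open>- \<i> (z k - cnj (z j))\<close>.\<close>

lemma pick_kernel_nonneg_aux: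
  assumes f: "f \<in> pick_class" and J: "finite J" "\<And>j. j \<in> J \<Longrightarrow> z j \<in> upper_half_plane"
  shows "0 \<le> Re (\<Sum>j\<in>J. \<Sum>k\<in>J. cnj (b j) * b k * (f (z k) / (z k - cnj (z j))))"
proof -
  define D where "D R j k = - 1 - cnj (z j) * z k - \<i> * of_real R * (z k - cnj (z j))" for R :: real and j k
  define S where "S R = (\<Sum>j\<in>J. \<Sum>k\<in>J. cnj (b j) * b k * (- \<i> * f (z k) / (D R j k / of_real R)))" for R
  have "\<forall>\<^sub>F R in at_top. 0 \<le> Re (S R)"
  proof -
    \<comment> \<open>This inequality says that \<open>z j\<close> is at distance less than
      \<open>r\<close> from the centre: the terms in \<open>R^2\<close> cancel, so it holds for all
      large \<open>R\<close>.\<close>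
    have "\<forall>\<^sub>F R in at_top. (cmod (z j))\<^sup>2 + 1 < 2 * R * Im (z j)" if "j \<in> J" for j
    proof -
      have "Im (z j) > 0"
        using J(2)[OF that] by (simp add: upper_half_plane_def)
      then have "(cmod (z j))\<^sup>2 + 1 < 2 * R * Im (z j)" if "R > ((cmod (z j))\<^sup>2 + 1) / (2 * Im (z j))" for R
        using that by (simp add: field_simps)
      then show ?thesis
        by (rule eventually_mono[OF eventually_gt_at_top])
    qed
    then have "\<forall>\<^sub>F R in at_top. \<forall>j\<in>J. (cmod (z j))\<^sup>2 + 1 < 2 * R * Im (z j)"
      using J(1) by (simp add: eventually_ball_finite)
    moreover have "\<forall>\<^sub>F R in at_top. (1::real) < R"
      by (rule eventually_gt_at_top)
    ultimately show ?thesis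
    proof eventually_elim
      case (elim R)
      define c where "c = \<i> * of_real R"
      \<comment> \<open>Taking 1 off \<open>R^2\<close> keeps the closed disc inside the open
        half-plane, where \<open>f\<close> is holomorphic.\<close>
      define r where "r = sqrt (R\<^sup>2 - 1)"
      have R2: "1 < R\<^sup>2"
        using elim by (simp add: one_less_power)
      have r: "r\<^sup>2 = R\<^sup>2 - 1" "0 < r"
        using R2 by (auto simp: r_def)
      have "r < R"
        using power2_less_imp_less[of r R] r(1) elim(2) by linarith
      have sub: "cball c r \<subseteq> upper_half_plane"
      proof
        fix u assume "u \<in> cball c r"
        then have "cmod (u - c) \<le> r"
          by (simp add: dist_norm norm_minus_commute)
        then have "\<bar>Im (u - c)\<bar> \<le> r"
          using abs_Im_le_cmod order_trans by blast
        then show "u \<in> upper_half_plane"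
          using \<open>r < R\<close> by (auto simp: c_def upper_half_plane_def)
      qed
      have "cmod (z j - c) < r" if "j \<in> J" for j
      proof -
        have "(cmod (z j - c))\<^sup>2 = (cmod (z j))\<^sup>2 - 2 * R * Im (z j) + R\<^sup>2"
          unfolding cmod_power2 by (simp add: c_def power2_eq_square algebra_simps)
        also have "\<dots> < r\<^sup>2"
          using elim that r by auto
        finally show ?thesis
          using power2_less_imp_less r(2) by (meson less_imp_le)
      qed
      \<comment> \<open>The disc kernel is applied to \<open>- \<i> * f\<close>, whose real part is
        \<open>Im f\<close>.\<close>
      then have nonneg: "0 \<le> Re (\<Sum>j\<in>J. \<Sum>k\<in>J. cnj (b j) * b k * (- \<i> * f (z k) / (of_real (r\<^sup>2) - cnj (z j - c) * (z k - c))))"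
        using f sub r(2) J(1)
        by (intro disc_kernel_nonneg) (auto simp: pick_class_def intro!: holomorphic_intros intro: holomorphic_on_subset)
      have "complex_of_real (r\<^sup>2) - cnj (z j - c) * (z k - c) = D R j k" for j k
        unfolding r(1) by (simp add: D_def c_def power2_eq_square algebra_simps)
      then have "0 \<le> R * Re (\<Sum>j\<in>J. \<Sum>k\<in>J. cnj (b j) * b k * (- \<i> * f (z k) / D R j k))"
        using elim(2) nonneg by (simp del: Re_sum complex_cnj_diff of_real_power of_real_diff)
      also have "\<dots> = Re (of_real R * (\<Sum>j\<in>J. \<Sum>k\<in>J. cnj (b j) * b k * (- \<i> * f (z k) / D R j k)))"
        by (simp del: Re_sum)
      also have "of_real R * (\<Sum>j\<in>J. \<Sum>k\<in>J. cnj (b j) * b k * (- \<i> * f (z k) / D R j k)) = S R"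
        by (simp add: S_def sum_distrib_left mult_ac)
      finally show ?case .
    qed
  qed
  moreover have "(S \<longlongrightarrow> (\<Sum>j\<in>J. \<Sum>k\<in>J. cnj (b j) * b k * (f (z k) / (z k - cnj (z j))))) at_top"
    unfolding S_def
  proof (intro tendsto_sum tendsto_mult_left)
    fix j k assume jk: "j \<in> J" "k \<in> J"
    have "Im (z k - cnj (z j)) > 0"
      using J(2)[OF jk(1)] J(2)[OF jk(2)] by (simp add: upper_half_plane_def)
    then have nz: "z k - cnj (z j) \<noteq> 0"
      by auto
    have "((\<lambda>R::real. (- 1 - cnj (z j) * z k) / of_real R) \<longlongrightarrow> 0) at_top"
      by (intro tendsto_divide_0[OF tendsto_const] filterlim_at_top_imp_at_infinity
          filterlim_compose[OF filterlim_of_real_at_infinity] filterlim_ident)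
    then have "((\<lambda>R::real. (- 1 - cnj (z j) * z k) / of_real R - \<i> * (z k - cnj (z j))) \<longlongrightarrow> 0 - \<i> * (z k - cnj (z j))) at_top"
      by (intro tendsto_intros)
    moreover have "\<forall>\<^sub>F R in at_top. (- 1 - cnj (z j) * z k) / of_real R - \<i> * (z k - cnj (z j)) = D R j k / of_real R"
      using eventually_gt_at_top[of 0] by eventually_elim (simp add: D_def diff_divide_distrib)
    ultimately have "((\<lambda>R. D R j k / of_real R) \<longlongrightarrow> - \<i> * (z k - cnj (z j))) at_top"
      by (simp add: filterlim_cong)
    then have "((\<lambda>R. - \<i> * f (z k) / (D R j k / of_real R)) \<longlongrightarrow> - \<i> * f (z k) / (- \<i> * (z k - cnj (z j)))) at_top"
      using nz by (intro tendsto_divide tendsto_const) auto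
    then show "((\<lambda>R. - \<i> * f (z k) / (D R j k / of_real R)) \<longlongrightarrow> f (z k) / (z k - cnj (z j))) at_top"
      by (simp add: divide_simps)
  qed
  then have "((\<lambda>R. Re (S R)) \<longlongrightarrow> Re (\<Sum>j\<in>J. \<Sum>k\<in>J. cnj (b j) * b k * (f (z k) / (z k - cnj (z j))))) at_top"
    by (rule tendsto_Re)
  ultimately show ?thesis
    by (intro tendsto_lowerbound[of _ _ at_top]) auto
qed

text \<open>The previous form \<open>S\<close> carries only the \<open>f (z k)\<close> half of the
  kernel. Conjugating and exchanging \<open>j\<close> with \<open>k\<close> gives the other half, so
  the sum is \<open>S + cnj S\<close>.\<close>

lemma pick_kernel_nonneg:
  assumes f: "f \<in> pick_class" and J: "finite J" "\<And>j. j \<in> J \<Longrightarrow> z j \<in> upper_half_plane"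
  shows "0 \<le> Re (\<Sum>j\<in>J. \<Sum>k\<in>J. cnj (b j) * b k * ((f (z k) - cnj (f (z j))) / (z k - cnj (z j))))"
proof -
  define S where "S = (\<Sum>j\<in>J. \<Sum>k\<in>J. cnj (b j) * b k * (f (z k) / (z k - cnj (z j))))"
  have "cnj (b j) * b k * ((f (z k) - cnj (f (z j))) / (z k - cnj (z j))) =
      cnj (b j) * b k * (f (z k) / (z k - cnj (z j))) +
      cnj (cnj (b k) * b j * (f (z j) / (z j - cnj (z k))))" for j k
  proof -
    have "cnj (z j - cnj (z k)) = - (z k - cnj (z j))"
      by simp
    then have "(f (z k) - cnj (f (z j))) / (z k - cnj (z j)) =
        f (z k) / (z k - cnj (z j)) + cnj (f (z j)) / cnj (z j - cnj (z k))"
      by (simp only: diff_divide_distrib divide_minus_right) simp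
    then show ?thesis
      by (simp add: distrib_left mult_ac)
  qed
  then have "(\<Sum>j\<in>J. \<Sum>k\<in>J. cnj (b j) * b k * ((f (z k) - cnj (f (z j))) / (z k - cnj (z j)))) =
      S + (\<Sum>j\<in>J. \<Sum>k\<in>J. cnj (cnj (b k) * b j * (f (z j) / (z j - cnj (z k)))))"
    by (simp only: S_def sum.distrib)
  also have "(\<Sum>j\<in>J. \<Sum>k\<in>J. cnj (cnj (b k) * b j * (f (z j) / (z j - cnj (z k))))) = cnj S"
    unfolding S_def cnj_sum by (rule sum.swap)
  finally have eq: "(\<Sum>j\<in>J. \<Sum>k\<in>J. cnj (b j) * b k * ((f (z k) - cnj (f (z j))) / (z k - cnj (z j)))) = S + cnj S" .
  have "0 \<le> Re S"
    unfolding S_def by (rule pick_kernel_nonneg_aux[OF assms])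
  then show ?thesis
    unfolding eq by simp
qed

section \<open>Expansions on the vertical ray\<close>

text \<open>The common consequence of the solution notions and the only boundary information that
  the Hankel form uses. Dividing by a power of the real \<open>y\<close> makes it easy to rescale
  the ray.\<close>

definition vertical_expansion :: "nat \<Rightarrow> real \<Rightarrow> (nat \<Rightarrow> real) \<Rightarrow> (complex \<Rightarrow> complex) \<Rightarrow> bool"
  where "vertical_expansion n x b f \<longleftrightarrow>
    ((\<lambda>y. (f (Complex x y) - (\<Sum>p\<le>n. of_real (b p) * (\<i> * of_real y) ^ p)) / of_real y ^ n)
      \<longlongrightarrow> 0) (at_right 0)"

lemma open_upper_half_plane: "open upper_half_plane"
  unfolding upper_half_plane_def by (rule open_halfspace_Im_gt)

text \<open>The vertical ray is itself an approach set: there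
  \<open>cmod (z - of_real x) / Im z\<close> equals 1.\<close>

lemma nt_tendsto_imp_vertical:
  assumes "nt_tendsto g x l"
  shows "((\<lambda>y. g (Complex x y)) \<longlongrightarrow> l) (at_right 0)"
proof -
  define S where "S = Complex x ` {0<..}"
  have lim: "(Complex x \<longlongrightarrow> of_real x) (at_right 0)"
    unfolding tendsto_complex_iff by (auto intro: tendsto_intros)
  have ev: "\<forall>\<^sub>F y in at_right 0. Complex x y \<in> S"
    using eventually_at_right_less[of 0] by eventually_elim (auto simp: S_def)
  have "of_real x \<in> closure S"
    by (rule Lim_in_closed_set[OF closed_closure eventually_mono[OF ev] _ lim])
      (auto intro: subsetD[OF closure_subset])
  moreover have "cmod (z - of_real x) / Im z \<le> 1" if "z \<in> S" for z
    using that by (auto simp: S_def cmod_def)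
  moreover have "S \<subseteq> upper_half_plane"
    by (auto simp: S_def upper_half_plane_def)
  ultimately have "nt_approach_set x S"
    unfolding nt_approach_set_def by blast
  then have "(g \<longlongrightarrow> l) (at (of_real x) within S)"
    using assms by (simp add: nt_tendsto_def)
  moreover have "filterlim (Complex x) (at (of_real x) within S) (at_right 0)"
    unfolding filterlim_at using lim ev eventually_at_right_less[of 0]
    by (auto simp: complex_eq_iff elim!: eventually_elim2)
  ultimately show ?thesis
    by (rule filterlim_compose)
qed

lemma nt_solution_imp_radial_solution: "nt_solution n x a f \<Longrightarrow> radial_solution n x a f"
  unfolding nt_solution_def radial_solution_def by (blast dest: nt_tendsto_imp_vertical)

lemma weak_solution_imp_vertical_expansion:
  assumes "weak_solution n x a f"
  obtains c where "c \<le> a n" "vertical_expansion n x (a(n := c)) f"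
proof -
  obtain c where c: "c \<le> a n"
    "nt_small_o (\<lambda>z. f z - ((\<Sum>k<n. of_real (a k) * (z - of_real x) ^ k)
        + of_real c * (z - of_real x) ^ n)) x n"
    using assms by (auto simp: weak_solution_def)
  have z: "Complex x y - of_real x = \<i> * of_real y" for y
    by (simp add: complex_eq_iff)
  have sum: "(\<Sum>k<n. of_real (a k) * w ^ k) + of_real c * w ^ n =
      (\<Sum>k\<le>n. of_real ((a(n := c)) k) * w ^ k)" for w :: complex
    by (simp add: lessThan_Suc_atMost[symmetric])
  have "((\<lambda>y. (f (Complex x y) - (\<Sum>k\<le>n. of_real ((a(n := c)) k) * (\<i> * of_real y) ^ k))
      / (\<i> * of_real y) ^ n) \<longlongrightarrow> 0) (at_right 0)"
    using nt_tendsto_imp_vertical[OF c(2)[unfolded nt_small_o_def]] by (simp only: z sum)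
  \<comment> \<open>The factor \<open>\<i> ^ n\<close> turns the denominator
    \<open>(\<i> y)^n\<close> into \<open>y^n\<close>.\<close>
  then have "((\<lambda>y. \<i> ^ n * ((f (Complex x y) - (\<Sum>k\<le>n. of_real ((a(n := c)) k) * (\<i> * of_real y) ^ k))
      / (\<i> * of_real y) ^ n)) \<longlongrightarrow> 0) (at_right 0)"
    by (rule tendsto_mult_right_zero)
  moreover have "\<i> ^ n * (w / (\<i> * of_real y) ^ n) = w / of_real y ^ n" for w y
    by (simp add: power_mult_distrib)
  ultimately have "vertical_expansion n x (a(n := c)) f"
    unfolding vertical_expansion_def by (simp only:)
  then show ?thesis
    using that c(1) by blast
qed

text \<open>Taylor's formula of order \<open>n - 1\<close> is applied to \<open>f\<close> minus its monomial of degree \<open>n\<close>, whose \<open>n\<close>-th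
  derivative is small near \<open>x\<close>; the base point \<open>w\<close> then tends to \<open>x\<close> along the ray.\<close>

lemma vertical_expansion_of_derivatives:
  assumes f: "f holomorphic_on upper_half_plane" and n: "0 < n"
    and lim: "\<And>k. k \<le> n \<Longrightarrow> ((\<lambda>y. (deriv ^^ k) f (Complex x y) / fact k) \<longlongrightarrow> of_real (b k)) (at_right 0)"
  shows "vertical_expansion n x b f"
proof -
  \<comment> \<open>The factorials make \<open>\<phi> i\<close> the \<open>i\<close>-th derivative
    of \<open>f - b n (z - x)^n\<close>, so that \<open>\<phi> n\<close> tends to 0 on the
    ray.\<close>
  define \<phi> where "\<phi> i z = (deriv ^^ i) f z -
    of_real (b n) * (fact n / fact (n - i)) * (z - of_real x) ^ (n - i)" for i z
  have deriv: "(\<phi> i has_field_derivative \<phi> (Suc i) z) (at z within A)"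
    if z: "z \<in> upper_half_plane" and i: "i < n" for i z A
  proof -
    have f_deriv: "((deriv ^^ i) f has_field_derivative (deriv ^^ Suc i) f z) (at z)"
      by (rule has_field_derivative_higher_deriv[OF f open_upper_half_plane z])
    obtain j where j: "n - i = Suc j"
      using i by (metis Suc_diff_Suc)
    then have "n - Suc i = j" by simp
    have fact_eq: "fact n / fact (Suc j) * of_nat (Suc j) = (fact n / fact j :: complex)"
      by (simp add: field_simps del: of_nat_Suc)
    have "((\<lambda>z. (z - of_real x) ^ Suc j) has_field_derivative of_nat (Suc j) * (z - of_real x) ^ j) (at z)"
    proof -
      have "((\<lambda>z. z - of_real x) has_field_derivative 1) (at z)"
        by (auto intro!: derivative_eq_intros)
      from DERIV_power_Suc[OF this, of j] show ?thesis
        by simp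
    qed
    from DERIV_cmult[OF this, of "of_real (b n) * (fact n / fact (Suc j))"]
    have "((\<lambda>z. of_real (b n) * (fact n / fact (n - i)) * (z - of_real x) ^ (n - i))
        has_field_derivative of_real (b n) * (fact n / fact (n - Suc i)) * (z - of_real x) ^ (n - Suc i)) (at z)"
      unfolding j \<open>n - Suc i = j\<close>
      by (simp only: mult.assoc fact_eq[symmetric])
    from DERIV_diff[OF f_deriv this] show ?thesis
      unfolding \<phi>_def by (rule has_field_derivative_at_within)
  qed
  have \<phi>_lim: "((\<lambda>y. \<phi> i (Complex x y) / fact i) \<longlongrightarrow> of_real (b i)) (at_right 0)" if "i < n" for i
  proof -
    have "((\<lambda>y. (\<i> * complex_of_real y) ^ (n - i)) \<longlongrightarrow> (\<i> * of_real 0) ^ (n - i)) (at_right 0)"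
      by (intro tendsto_intros)
    moreover have "(\<i> * complex_of_real 0) ^ (n - i) = 0"
      using that by simp
    ultimately have "((\<lambda>y. (\<i> * complex_of_real y) ^ (n - i)) \<longlongrightarrow> 0) (at_right 0)"
      by (simp only:)
    then have "((\<lambda>y. of_real (b n) * (fact n / fact (n - i)) / fact i * (\<i> * complex_of_real y) ^ (n - i)) \<longlongrightarrow> 0) (at_right 0)"
      by (rule tendsto_mult_right_zero)
    then have "((\<lambda>y. (deriv ^^ i) f (Complex x y) / fact i -
        of_real (b n) * (fact n / fact (n - i)) / fact i * (\<i> * complex_of_real y) ^ (n - i)) \<longlongrightarrow> of_real (b i) - 0) (at_right 0)"
      by (intro tendsto_diff lim) (use that in auto)
    moreover have "Complex x y - of_real x = \<i> * of_real y" for y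
      by (simp add: complex_eq_iff)
    ultimately show ?thesis
      by (simp add: \<phi>_def diff_divide_distrib)
  qed
  show ?thesis
    unfolding vertical_expansion_def
  proof (rule tendstoI)
    fix \<epsilon> :: real assume "0 < \<epsilon>"
    have "((\<lambda>y. (deriv ^^ n) f (Complex x y) / fact n - of_real (b n)) \<longlongrightarrow> of_real (b n) - of_real (b n)) (at_right 0)"
      by (intro tendsto_diff lim tendsto_const) simp
    then have "((\<lambda>y. fact n * ((deriv ^^ n) f (Complex x y) / fact n - of_real (b n))) \<longlongrightarrow> 0) (at_right 0)"
      by (intro tendsto_mult_right_zero) simp
    then have "((\<lambda>y. \<phi> n (Complex x y)) \<longlongrightarrow> 0) (at_right 0)"
      by (simp add: \<phi>_def right_diff_distrib mult_ac)
    then have "\<forall>\<^sub>F y in at_right 0. cmod (\<phi> n (Complex x y)) < \<epsilon> / 2"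
      using tendstoD[of "\<lambda>y. \<phi> n (Complex x y)" 0 "at_right 0" "\<epsilon> / 2"] \<open>0 < \<epsilon>\<close>
      by (simp only: dist_norm diff_zero half_gt_zero)
    then obtain \<delta> where \<delta>: "0 < \<delta>" "\<And>y. 0 < y \<Longrightarrow> y < \<delta> \<Longrightarrow> cmod (\<phi> n (Complex x y)) < \<epsilon> / 2"
      unfolding eventually_at_right_field by auto
    have "\<forall>\<^sub>F y in at_right 0. y \<in> {0<..<\<delta>}"
      by (rule eventually_at_right_real[OF \<delta>(1)])
    then show "\<forall>\<^sub>F y in at_right 0. dist ((f (Complex x y) -
        (\<Sum>p\<le>n. of_real (b p) * (\<i> * of_real y) ^ p)) / of_real y ^ n) 0 < \<epsilon>"
    proof eventually_elim
      case (elim y)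
      \<comment> \<open>Taylor's formula is used on a segment of the ray, because nothing is known
        about \<open>\<phi> n\<close> off the ray; a segment is convex, as the formula
        requires.\<close>
      define S where "S = Complex x ` {0<..<\<delta>}"
      have S_eq: "S = (\<lambda>t. of_real x + t *\<^sub>R \<i>) ` {0<..<\<delta>}"
        by (auto simp: S_def complex_eq_iff intro!: image_cong)
      have "convex S"
        unfolding S_eq
        by (subst image_image[of "\<lambda>w. of_real x + w" "\<lambda>t. t *\<^sub>R \<i>", symmetric])
          (intro convex_translation convex_linear_image, auto intro: bounded_linear.linear bounded_linear_scaleR_left)
      have S_sub: "S \<subseteq> upper_half_plane"
        by (auto simp: S_def upper_half_plane_def)
      have y: "Complex x y \<in> S"
        using elim by (auto simp: S_def)
      obtain N where N: "n = Suc N"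
        using n by (cases n) auto
      have taylor: "cmod (\<phi> 0 (Complex x y) - (\<Sum>i\<le>N. \<phi> i w * (Complex x y - w) ^ i / fact i))
          \<le> \<epsilon> / 2 * cmod (Complex x y - w) ^ Suc N / fact N" if "w \<in> S" for w
        by (rule complex_Taylor[OF \<open>convex S\<close> _ _ that y])
          (use deriv S_sub \<delta>(2) in \<open>auto simp: N S_def less_imp_le\<close>)
      have w_lim: "(Complex x \<longlongrightarrow> of_real x) (at_right 0)"
        unfolding tendsto_complex_iff by (auto intro: tendsto_intros)
      have "((\<lambda>t. cmod (\<phi> 0 (Complex x y) - (\<Sum>i\<le>N. \<phi> i (Complex x t) / fact i * (Complex x y - Complex x t) ^ i)))
          \<longlongrightarrow> cmod (\<phi> 0 (Complex x y) - (\<Sum>i\<le>N. of_real (b i) * (Complex x y - of_real x) ^ i))) (at_right 0)"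
        by (intro tendsto_intros \<phi>_lim w_lim) (use N in auto)
      moreover have "((\<lambda>t. \<epsilon> / 2 * cmod (Complex x y - Complex x t) ^ Suc N / fact N) \<longlongrightarrow>
          \<epsilon> / 2 * cmod (Complex x y - of_real x) ^ Suc N / fact N) (at_right 0)"
        by (intro tendsto_intros w_lim) auto
      moreover have "\<forall>\<^sub>F t in at_right 0. cmod (\<phi> 0 (Complex x y) -
          (\<Sum>i\<le>N. \<phi> i (Complex x t) / fact i * (Complex x y - Complex x t) ^ i))
          \<le> \<epsilon> / 2 * cmod (Complex x y - Complex x t) ^ Suc N / fact N"
        using eventually_at_right_real[OF \<delta>(1)]
      proof eventually_elim
        case (elim t)
        then show ?case
          using taylor[of "Complex x t"] by (simp add: S_def)
      qed
      ultimately have "cmod (\<phi> 0 (Complex x y) - (\<Sum>i\<le>N. of_real (b i) * (Complex x y - of_real x) ^ i))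
          \<le> \<epsilon> / 2 * cmod (Complex x y - of_real x) ^ Suc N / fact N"
        by (intro tendsto_le[of "at_right 0"]) auto
      moreover have y_eq: "Complex x y - of_real x = \<i> * of_real y"
        by (simp add: complex_eq_iff)
      moreover have "\<phi> 0 (Complex x y) - (\<Sum>i\<le>N. of_real (b i) * (\<i> * of_real y) ^ i) =
          f (Complex x y) - (\<Sum>p\<le>n. of_real (b p) * (\<i> * of_real y) ^ p)"
      proof -
        have "\<phi> 0 (Complex x y) = f (Complex x y) - of_real (b n) * (\<i> * of_real y) ^ n"
          unfolding \<phi>_def y_eq by simp
        then show ?thesis
          by (simp add: N)
      qed
      ultimately have "cmod (f (Complex x y) - (\<Sum>p\<le>n. of_real (b p) * (\<i> * of_real y) ^ p))
          \<le> \<epsilon> / 2 * y ^ n / fact N"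
        using elim by (simp add: N norm_mult)
      also have "\<dots> \<le> \<epsilon> / 2 * y ^ n / 1"
        using elim \<open>0 < \<epsilon>\<close> by (intro divide_left_mono fact_ge_1) auto
      also have "\<dots> < \<epsilon> * y ^ n"
        using elim \<open>0 < \<epsilon>\<close> by simp
      finally show ?case
        using elim by (simp add: norm_divide norm_power divide_less_eq)
    qed
  qed
qed

lemma radial_solution_imp_vertical_expansion:
  assumes "radial_solution n x a f" "0 < n"
  obtains c where "c \<le> a n" "vertical_expansion n x (a(n := c)) f"
proof -
  obtain c where c: "c \<le> a n"
    "((\<lambda>y::real. (deriv ^^ n) f (Complex x y) / fact n) \<longlongrightarrow> of_real c) (at_right 0)"
    using assms(1) by (auto simp: radial_solution_def)
  have "vertical_expansion n x (a(n := c)) f"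
    by (rule vertical_expansion_of_derivatives)
      (use assms c(2) in \<open>auto simp: radial_solution_def pick_class_def\<close>)
  then show ?thesis
    using that c(1) by blast
qed

section \<open>Boundary behaviour of analytic solutions\<close>

lemma analytic_solution_imp_nt_solution:
  assumes "analytic_solution n x a f"
  shows "nt_solution n x a f"
proof -
  obtain U g c where U: "open U" "of_real x \<in> U" and g: "g holomorphic_on U"
    and gf: "\<And>z. z \<in> U \<inter> upper_half_plane \<Longrightarrow> g z = f z"
    and coeffs: "\<And>k. k < n \<Longrightarrow> (deriv ^^ k) g (of_real x) / fact k = of_real (a k)"
    and c: "c \<le> a n" "(deriv ^^ n) g (of_real x) / fact n = of_real c"
    using assms by (auto simp: analytic_solution_def)
  have f: "f \<in> pick_class"
    using assms by (simp add: analytic_solution_def)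
  have lim: "nt_tendsto (\<lambda>z. (deriv ^^ k) f z / fact k) x ((deriv ^^ k) g (of_real x) / fact k)" for k
    unfolding nt_tendsto_def
  proof (intro allI impI)
    fix S assume S: "nt_approach_set x S"
    have "(deriv ^^ k) g holomorphic_on U"
      by (rule holomorphic_higher_deriv[OF g U(1)])
    then have "isCont ((deriv ^^ k) g) (of_real x)"
      using U holomorphic_on_imp_continuous_on continuous_on_eq_continuous_at by blast
    then have "((deriv ^^ k) g \<longlongrightarrow> (deriv ^^ k) g (of_real x)) (at (of_real x) within S)"
      using continuous_at_imp_continuous_at_within continuous_within by blast
    then have "((\<lambda>z. (deriv ^^ k) g z / fact k) \<longlongrightarrow> (deriv ^^ k) g (of_real x) / fact k) (at (of_real x) within S)"
      by (intro tendsto_intros) auto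
    moreover have "\<forall>\<^sub>F z in at (of_real x) within S. (deriv ^^ k) g z / fact k = (deriv ^^ k) f z / fact k"
    proof -
      have "\<forall>\<^sub>F z in at (of_real x) within S. z \<in> U"
        by (rule topological_tendstoD[OF tendsto_ident_at U])
      moreover have "\<forall>\<^sub>F z in at (of_real x) within S. z \<in> S"
        by (auto simp: eventually_at_filter)
      ultimately show ?thesis
      proof eventually_elim
        case (elim z)
        then have "z \<in> U \<inter> upper_half_plane"
          using S by (auto simp: nt_approach_set_def)
        then have "(deriv ^^ k) g z = (deriv ^^ k) f z"
          using g f U(1) open_upper_half_plane gf
          by (intro higher_deriv_transform_within_open[of _ "U \<inter> upper_half_plane"])
            (auto simp: pick_class_def intro: holomorphic_on_subset)
        then show ?case by simp
      qed
    qed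
    ultimately show "((\<lambda>z. (deriv ^^ k) f z / fact k) \<longlongrightarrow> (deriv ^^ k) g (of_real x) / fact k) (at (of_real x) within S)"
      by (rule Lim_transform_eventually)
  qed
  show ?thesis
    unfolding nt_solution_def
  proof (intro conjI allI impI exI[of _ c])
    show "nt_tendsto (\<lambda>z. (deriv ^^ k) f z / fact k) x (of_real (a k))" if "k < n" for k
      using lim[of k] coeffs[OF that] by simp
    show "nt_tendsto (\<lambda>z. (deriv ^^ n) f z / fact n) x (of_real c)"
      using lim[of n] c by simp
  qed (use f c in auto)
qed

text \<open>By compactness the derivative of order \<open>n + 1\<close> of the extension is bounded
  near \<open>x\<close>, so the Taylor remainder gains a full power of \<open>z - x\<close> over
  what the small-o condition demands.\<close>

lemma analytic_solution_imp_weak_solution: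
  assumes "analytic_solution n x a f"
  shows "weak_solution n x a f"
proof -
  obtain U g c where U: "open U" "of_real x \<in> U" and g: "g holomorphic_on U"
    and gf: "\<And>z. z \<in> U \<inter> upper_half_plane \<Longrightarrow> g z = f z"
    and coeffs: "\<And>k. k < n \<Longrightarrow> (deriv ^^ k) g (of_real x) / fact k = of_real (a k)"
    and c: "c \<le> a n" "(deriv ^^ n) g (of_real x) / fact n = of_real c"
    using assms by (auto simp: analytic_solution_def)
  define p where "p z = (\<Sum>k<n. of_real (a k) * (z - of_real x) ^ k) + of_real c * (z - of_real x) ^ n" for z :: complex
  obtain r where r: "0 < r" "cball (of_real x) r \<subseteq> U"
    using U open_contains_cball by blast
  have "continuous_on (cball (of_real x) r) ((deriv ^^ Suc n) g)"
    using holomorphic_on_imp_continuous_on[OF holomorphic_higher_deriv[OF g U(1), of "Suc n"]] r(2)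
      continuous_on_subset by blast
  then have "bounded ((deriv ^^ Suc n) g ` cball (of_real x) r)"
    by (intro compact_imp_bounded compact_continuous_image) auto
  then obtain B where B: "\<And>z. z \<in> cball (of_real x) r \<Longrightarrow> cmod ((deriv ^^ Suc n) g z) \<le> B"
    unfolding bounded_iff by blast
  have p_eq: "p z = (\<Sum>k\<le>n. (deriv ^^ k) g (of_real x) * (z - of_real x) ^ k / fact k)" for z
  proof -
    have "(\<Sum>k\<le>n. (deriv ^^ k) g (of_real x) * (z - of_real x) ^ k / fact k) =
        (\<Sum>k\<le>n. (deriv ^^ k) g (of_real x) / fact k * (z - of_real x) ^ k)"
      by simp
    also have "\<dots> = p z"
      unfolding lessThan_Suc_atMost[symmetric] sum.lessThan_Suc p_def c(2) by (simp add: coeffs)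
    finally show ?thesis ..
  qed
  have taylor: "cmod (g z - p z) \<le> B * cmod (z - of_real x) ^ Suc n / fact n" if "z \<in> cball (of_real x) r" for z
    unfolding p_eq
  proof (rule complex_Taylor[where f = "\<lambda>k. (deriv ^^ k) g" and S = "cball (of_real x) r", simplified funpow_0])
    show "((deriv ^^ i) g has_field_derivative (deriv ^^ Suc i) g w) (at w within cball (of_real x) r)"
      if "w \<in> cball (of_real x) r" for i w
      using has_field_derivative_higher_deriv[OF g U(1)] that r(2) has_field_derivative_at_within by blast
  qed (use B that r in auto)
  have "nt_small_o (\<lambda>z. f z - p z) x n"
    unfolding nt_small_o_def nt_tendsto_def
  proof (intro allI impI)
    fix S assume S: "nt_approach_set x S"
    have "((\<lambda>z. B * cmod (z - of_real x) / fact n) \<longlongrightarrow> B * cmod (of_real x - of_real x) / fact n) (at (of_real x) within S)"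
      by (intro tendsto_intros) auto
    then have "((\<lambda>z. B * cmod (z - of_real x) / fact n) \<longlongrightarrow> 0) (at (of_real x) within S)"
      by simp
    moreover have in_ball: "\<forall>\<^sub>F z in at (of_real x) within S. z \<in> ball (of_real x) r"
      by (rule topological_tendstoD[OF tendsto_ident_at]) (use r in auto)
    have in_S: "\<forall>\<^sub>F z in at (of_real x) within S. z \<in> S \<and> z \<noteq> of_real x"
      unfolding eventually_at_filter by (rule always_eventually) auto
    have "\<forall>\<^sub>F z in at (of_real x) within S.
        cmod ((f z - p z) / (z - of_real x) ^ n) \<le> B * cmod (z - of_real x) / fact n"
      using in_ball in_S
    proof eventually_elim
      case z: (elim z)
      have "g z = f z"
        using S z r(2) by (intro gf) (auto simp: nt_approach_set_def)
      then have "cmod (f z - p z) \<le> B * cmod (z - of_real x) ^ Suc n / fact n"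
        using taylor[of z] z by auto
      then show ?case
        using z by (simp add: norm_divide norm_power field_simps)
    qed
    ultimately show "((\<lambda>z. (f z - p z) / (z - of_real x) ^ n) \<longlongrightarrow> 0) (at (of_real x) within S)"
      by (rule Lim_null_comparison[rotated])
  qed
  then show ?thesis
    using assms c(1) by (auto simp: weak_solution_def analytic_solution_def p_def)
qed

section \<open>From the Pick kernel to the Hankel form\<close>

text \<open>Comparing coefficients in the interpolation formula for \<open>monom 1 p\<close>: the
  coefficients of the basis polynomials form the inverse of the Vandermonde matrix of
  \<open>T\<close>.\<close>

lemma lagrange_basis_dual:
  assumes "finite T" "p < card T"
  shows "(\<Sum>t\<in>T. coeff (lagrange_basis T t) q * t ^ p) = (if q = p then 1 else 0)"
proof -
  have "degree (monom (1::'a) p) < card T"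
    using degree_monom_le assms(2) le_less_trans by blast
  then have "coeff (\<Sum>t\<in>T. smult (poly (monom 1 p) t) (lagrange_basis T t)) q = coeff (monom 1 p) q"
    by (simp only: lagrange_interpolation[OF assms(1)])
  then show ?thesis
    by (auto simp: coeff_sum poly_monom mult.commute)
qed

text \<open>The substitution is \<open>p = i + l + 1\<close>. Every pair in the square has
  \<open>i + l + 1 \<le> 2 * m - 1 = n\<close>, so cutting the outer sum at \<open>n\<close> loses
  nothing.\<close>

lemma sum_antidiagonal_square:
  fixes g :: "nat \<Rightarrow> nat \<Rightarrow> 'a::comm_monoid_add"
  assumes "\<And>i l. \<not> (i < m \<and> l < m) \<Longrightarrow> g i l = 0" "n = 2 * m - 1"
  shows "(\<Sum>p\<le>n. \<Sum>i<p. g i (p - Suc i)) = (\<Sum>i<m. \<Sum>l<m. g i l)"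
proof -
  have "(\<Sum>p\<le>n. \<Sum>i<p. g i (p - Suc i)) = (\<Sum>(p, i)\<in>(SIGMA p:{..n}. {..<p}). g i (p - Suc i))"
    by (subst sum.Sigma) auto
  also have "\<dots> = (\<Sum>(i, l)\<in>{..<m} \<times> {..<m}. g i l)"
    by (rule sum.reindex_bij_witness_not_neutral[where j = "\<lambda>(p, i). (i, p - Suc i)"
          and i = "\<lambda>(i, l). (i + l + 1, i)"
          and S' = "{(p, i). i < p \<and> p \<le> n \<and> \<not> (i < m \<and> p - Suc i < m)}" and T' = "{}"])
      (use assms in \<open>auto intro: finite_subset[of _ "{..n} \<times> {..n}"]\<close>)
  also have "\<dots> = (\<Sum>i<m. \<Sum>l<m. g i l)"
    by (simp add: sum.cartesian_product)
  finally show ?thesis .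
qed

lemma sum_swap_nested:
  fixes g :: "nat \<Rightarrow> nat \<Rightarrow> nat \<Rightarrow> nat \<Rightarrow> 'a::comm_monoid_add"
  shows "(\<Sum>j<m. \<Sum>k<m. \<Sum>p\<le>n. \<Sum>i<p. g j k p i) = (\<Sum>p\<le>n. \<Sum>i<p. \<Sum>j<m. \<Sum>k<m. g j k p i)"
proof -
  have triangle: "(\<Sum>p\<le>n. \<Sum>i<p. h p i) = (\<Sum>w\<in>(SIGMA p:{..n}. {..<p}). h (fst w) (snd w))"
    for h :: "nat \<Rightarrow> nat \<Rightarrow> 'a"
    by (simp add: sum.Sigma split_beta)
  have square: "(\<Sum>j<m. \<Sum>k<m. h j k) = (\<Sum>u\<in>{..<m} \<times> {..<m}. h (fst u) (snd u))"
    for h :: "nat \<Rightarrow> nat \<Rightarrow> 'a"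
    by (simp add: sum.cartesian_product split_beta)
  show ?thesis
    unfolding triangle square by (rule sum.swap)
qed

text \<open>By duality the weights \<open>c k y\<close> satisfy \<open>S p y = v p\<close> for \<open>p < m\<close>, whereas \<open>S p y\<close> tends to 0 for
  \<open>p \<ge> m\<close>. They grow only like \<open>y\<^sup>1\<^sup>-\<^sup>m\<close>, so the error of the expansion is harmless.\<close>

lemma pick_hankel_form_nonneg:
  fixes x :: real and b :: "nat \<Rightarrow> real" and v :: "nat \<Rightarrow> complex"
  assumes f: "f \<in> pick_class" and m: "0 < m" and n: "n = 2 * m - 1"
    and expansion: "vertical_expansion n x b f"
  shows "0 \<le> Re (\<Sum>i<m. \<Sum>l<m. of_real (b (i + l + 1)) * v i * cnj (v l))"
proof -
  \<comment> \<open>The sampling points \<open>z k y\<close> are \<open>x + y * \<tau> k\<close>.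
    With directions that do not depend on \<open>y\<close>, one Vandermonde inverse serves for all
    \<open>y\<close>; starting at \<open>Suc 0\<close> keeps the points off the real line.\<close>
  define \<tau> where "\<tau> k = \<i> * of_nat (Suc k)" for k
  define T where "T = \<tau> ` {..<m}"
  have inj: "inj_on \<tau> {..<m}"
    by (auto simp: inj_on_def \<tau>_def)
  have T: "finite T" "card T = m"
    by (simp_all add: T_def card_image inj)
  define d where "d k = lagrange_basis T (\<tau> k)" for k
  have dual: "(\<Sum>k<m. coeff (d k) q * \<tau> k ^ p) = (if q = p then 1 else 0)" if "p < m" for p q
    using lagrange_basis_dual[of T p q] that inj T by (simp add: T_def d_def sum.reindex)
  \<comment> \<open>Dividing by \<open>y^q\<close> offsets the scaling of the sampling points, so
    that the monomial of degree \<open>p < m\<close> is sent to exactly \<open>v p\<close>.\<close>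
  define c where "c k y = (\<Sum>q<m. v q * coeff (d k) q / of_real y ^ q)" for k and y :: real
  define B where "B k y = (\<Sum>q<m. v q * coeff (d k) q * of_real y ^ (m - Suc q))" for k and y :: real
  define z where "z k y = Complex x (real (Suc k) * y)" for k y
  define S where "S p y = (\<Sum>k<m. c k y * (of_real y * \<tau> k) ^ p)" for p and y :: real
  define e where "e k y = f (z k y) - (\<Sum>p\<le>n. of_real (b p) * (of_real y * \<tau> k) ^ p)" for k y
  define K where "K j k y = (f (z k y) - cnj (f (z j y))) / (z k y - cnj (z j y))" for j k y
  \<comment> \<open>The contribution of the errors with the powers of \<open>y\<close> collected:
    two weights cost \<open>2 * (m - 1)\<close> of them and the denominator of the kernel one more,
    in total \<open>n\<close>.\<close>
  define E where "E y = (\<Sum>j<m. \<Sum>k<m. cnj (B j y) * B k y *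
      ((e k y / of_real y ^ n - cnj (e j y / of_real y ^ n)) / (\<tau> k - cnj (\<tau> j))))" for y :: real
  define \<sigma> where "\<sigma> p = (if p < m then v p else 0)" for p
  have cB: "c k y = B k y / of_real y ^ (m - 1)" if "y > 0" for k y
    unfolding c_def B_def sum_divide_distrib
  proof (rule sum.cong)
    fix q assume "q \<in> {..<m}"
    then have "m - 1 = (m - Suc q) + q" by simp
    then show "v q * coeff (d k) q / complex_of_real y ^ q =
        v q * coeff (d k) q * of_real y ^ (m - Suc q) / of_real y ^ (m - 1)"
      using that by (simp add: power_add)
  qed simp
  have S_eq: "S p y = v p" if "p < m" "y > 0" for p y
  proof -
    have "S p y = (\<Sum>k<m. \<Sum>q<m. v q / of_real y ^ q * of_real y ^ p * (coeff (d k) q * \<tau> k ^ p))"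
      by (simp add: S_def c_def sum_distrib_left sum_distrib_right power_mult_distrib mult_ac)
    also have "\<dots> = (\<Sum>q<m. v q / of_real y ^ q * of_real y ^ p * (\<Sum>k<m. coeff (d k) q * \<tau> k ^ p))"
      by (subst sum.swap) (simp add: sum_distrib_left)
    also have "\<dots> = (\<Sum>q<m. if q = p then v p else 0)"
      by (rule sum.cong) (use that in \<open>auto simp: dual\<close>)
    finally show ?thesis
      using that by simp
  qed
  have B_lim: "(B k \<longlongrightarrow> (\<Sum>q<m. v q * coeff (d k) q * of_real 0 ^ (m - Suc q))) (at_right 0)" for k
    unfolding B_def by (intro tendsto_intros)
  have S_lim: "(S p \<longlongrightarrow> \<sigma> p) (at_right 0)" for p
  proof (cases "p < m")
    case True
    have "\<forall>\<^sub>F y in at_right 0. S p y = v p"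
      using eventually_at_right_less[of 0] by eventually_elim (simp add: S_eq True)
    then show ?thesis
      using True by (simp add: \<sigma>_def tendsto_eventually)
  next
    case False
    \<comment> \<open>The weights use up \<open>m - 1\<close> powers of \<open>y\<close>; for
      \<open>p \<ge> m\<close> at least one is left over.\<close>
    have "((\<lambda>y. \<Sum>k<m. B k y * of_real y ^ (p - (m - 1)) * \<tau> k ^ p) \<longlongrightarrow>
        (\<Sum>k<m. (\<Sum>q<m. v q * coeff (d k) q * of_real 0 ^ (m - Suc q)) * of_real 0 ^ (p - (m - 1)) * \<tau> k ^ p))
        (at_right 0)"
      by (intro tendsto_intros B_lim)
    moreover have "complex_of_real 0 ^ (p - (m - 1)) = 0"
      using False m by simp
    ultimately have "((\<lambda>y. \<Sum>k<m. B k y * of_real y ^ (p - (m - 1)) * \<tau> k ^ p) \<longlongrightarrow> 0) (at_right 0)"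
      by (simp only: mult_zero_left mult_zero_right sum.neutral_const)
    moreover have "\<forall>\<^sub>F y in at_right 0. (\<Sum>k<m. B k y * of_real y ^ (p - (m - 1)) * \<tau> k ^ p) = S p y"
      using eventually_at_right_less[of 0]
    proof eventually_elim
      case (elim y)
      have "p = (m - 1) + (p - (m - 1))"
        using False m by simp
      then have "complex_of_real y ^ p = of_real y ^ (m - 1) * of_real y ^ (p - (m - 1))"
        by (metis power_add)
      then show ?case
        using elim by (simp add: S_def cB power_mult_distrib mult_ac)
    qed
    ultimately have "(S p \<longlongrightarrow> 0) (at_right 0)"
      by (rule Lim_transform_eventually)
    then show ?thesis
      using False by (simp add: \<sigma>_def)
  qed
  have e_lim: "((\<lambda>y. e k y / of_real y ^ n) \<longlongrightarrow> 0) (at_right 0)" for k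
  proof -
    have "filterlim (\<lambda>y. real (Suc k) * y) (at_right 0) (at_right 0)"
      using filtermap_times_pos_at_right[of "real (Suc k)" 0] by (simp add: filterlim_def del: of_nat_Suc)
    then have "((\<lambda>y. (f (Complex x (real (Suc k) * y)) - (\<Sum>p\<le>n. of_real (b p) * (\<i> * of_real (real (Suc k) * y)) ^ p))
        / of_real (real (Suc k) * y) ^ n) \<longlongrightarrow> 0) (at_right 0)"
      by (rule filterlim_compose[OF expansion[unfolded vertical_expansion_def]])
    then have "((\<lambda>y. of_real (real (Suc k)) ^ n * ((f (Complex x (real (Suc k) * y)) -
        (\<Sum>p\<le>n. of_real (b p) * (\<i> * of_real (real (Suc k) * y)) ^ p))
        / of_real (real (Suc k) * y) ^ n)) \<longlongrightarrow> 0) (at_right 0)"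
      by (rule tendsto_mult_right_zero)
    moreover have "complex_of_real (real (Suc k)) ^ n * (w / of_real (real (Suc k) * y) ^ n) = w / of_real y ^ n" for y w
      by (simp add: power_mult_distrib del: of_nat_Suc)
    moreover have "\<i> * of_real (real (Suc k) * y) = of_real y * \<tau> k" for y
      by (simp add: \<tau>_def mult_ac)
    ultimately show ?thesis
      unfolding e_def z_def by (simp only:)
  qed
  have "(E \<longlongrightarrow> (\<Sum>j<m. \<Sum>k<m. cnj (\<Sum>q<m. v q * coeff (d j) q * of_real 0 ^ (m - Suc q)) *
      (\<Sum>q<m. v q * coeff (d k) q * of_real 0 ^ (m - Suc q)) *
      ((0 - cnj 0) / (\<tau> k - cnj (\<tau> j))))) (at_right 0)"
  proof -
    have "\<tau> k - cnj (\<tau> j) \<noteq> 0" for j k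
      by (simp add: \<tau>_def complex_eq_iff)
    then show ?thesis
      unfolding E_def by (intro tendsto_intros B_lim e_lim)
  qed
  then have E_lim: "(E \<longlongrightarrow> 0) (at_right 0)"
    by simp
  have kernel: "(\<Sum>j<m. \<Sum>k<m. cnj (c j y) * c k y * K j k y) =
      (\<Sum>p\<le>n. \<Sum>i<p. of_real (b p) * S i y * cnj (S (p - Suc i) y)) + E y" if y: "y > 0" for y
  proof -
    \<comment> \<open>Since the \<open>b p\<close> are real, the polynomial parts of
      \<open>f (z k y)\<close> and its conjugate counterpart combine to differences of
      \<open>p\<close>-th powers, which the denominator divides.\<close>
    have K_eq: "K j k y = (\<Sum>p\<le>n. \<Sum>i<p. of_real (b p) * (of_real y * \<tau> k) ^ i * cnj ((of_real y * \<tau> j) ^ (p - Suc i)))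
        + (e k y - cnj (e j y)) / (of_real y * (\<tau> k - cnj (\<tau> j)))" for j k
    proof -
      define w where "w k = of_real y * \<tau> k" for k
      have wz: "z k y - cnj (z j y) = w k - cnj (w j)"
        by (simp add: z_def w_def \<tau>_def complex_eq_iff algebra_simps)
      have nz: "w k - cnj (w j) \<noteq> 0"
      proof -
        have "Im (w k - cnj (w j)) = y * real (Suc k + Suc j)"
          by (simp add: w_def \<tau>_def algebra_simps)
        also have "\<dots> > 0"
          using y by simp
        finally show ?thesis by auto
      qed
      have "f (z k y) - cnj (f (z j y)) = (\<Sum>p\<le>n. of_real (b p) * (w k ^ p - cnj (w j) ^ p)) + (e k y - cnj (e j y))"
        by (simp add: e_def w_def sum_subtractf right_diff_distrib)
      also have "(\<Sum>p\<le>n. of_real (b p) * (w k ^ p - cnj (w j) ^ p)) =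
          (w k - cnj (w j)) * (\<Sum>p\<le>n. \<Sum>i<p. of_real (b p) * w k ^ i * cnj (w j ^ (p - Suc i)))"
        by (simp add: power_diff_sumr2 sum_distrib_left mult_ac)
      finally show ?thesis
        using nz unfolding K_def wz by (simp add: add_divide_distrib w_def right_diff_distrib)
    qed
    have "(\<Sum>j<m. \<Sum>k<m. cnj (c j y) * c k y * K j k y) =
        (\<Sum>j<m. \<Sum>k<m. \<Sum>p\<le>n. \<Sum>i<p. of_real (b p) * (c k y * (of_real y * \<tau> k) ^ i) *
          cnj (c j y * (of_real y * \<tau> j) ^ (p - Suc i)))
        + (\<Sum>j<m. \<Sum>k<m. cnj (c j y) * c k y * ((e k y - cnj (e j y)) / (of_real y * (\<tau> k - cnj (\<tau> j)))))"
      by (simp add: K_eq distrib_left sum.distrib sum_distrib_left mult_ac)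
    also have "(\<Sum>j<m. \<Sum>k<m. \<Sum>p\<le>n. \<Sum>i<p. of_real (b p) * (c k y * (of_real y * \<tau> k) ^ i) *
          cnj (c j y * (of_real y * \<tau> j) ^ (p - Suc i))) =
        (\<Sum>p\<le>n. \<Sum>i<p. \<Sum>j<m. \<Sum>k<m. of_real (b p) * (c k y * (of_real y * \<tau> k) ^ i) *
          cnj (c j y * (of_real y * \<tau> j) ^ (p - Suc i)))"
      by (rule sum_swap_nested)
    also have "\<dots> = (\<Sum>p\<le>n. \<Sum>i<p. of_real (b p) * S i y * cnj (S (p - Suc i) y))"
    proof (intro sum.cong refl)
      fix p i
      show "(\<Sum>j<m. \<Sum>k<m. of_real (b p) * (c k y * (of_real y * \<tau> k) ^ i) *
          cnj (c j y * (of_real y * \<tau> j) ^ (p - Suc i))) = of_real (b p) * S i y * cnj (S (p - Suc i) y)"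
        unfolding S_def cnj_sum mult.assoc[of "of_real (b p)"] sum_product
        by (subst sum.swap) (simp only: sum_distrib_left)
    qed
    also have "(\<Sum>j<m. \<Sum>k<m. cnj (c j y) * c k y * ((e k y - cnj (e j y)) / (of_real y * (\<tau> k - cnj (\<tau> j))))) = E y"
    proof -
      have "n = Suc ((m - 1) + (m - 1))"
        using m n by simp
      then have "complex_of_real y ^ n = of_real y ^ (m - 1) * of_real y ^ (m - 1) * of_real y"
        by (simp add: power_add)
      then show ?thesis
        using y by (simp add: E_def cB diff_divide_distrib[symmetric] mult_ac)
    qed
    finally show ?thesis .
  qed
  have "((\<lambda>y. Re ((\<Sum>p\<le>n. \<Sum>i<p. of_real (b p) * S i y * cnj (S (p - Suc i) y)) + E y)) \<longlongrightarrow>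
      Re ((\<Sum>p\<le>n. \<Sum>i<p. of_real (b p) * \<sigma> i * cnj (\<sigma> (p - Suc i))) + 0)) (at_right 0)"
    by (intro tendsto_intros S_lim E_lim)
  moreover have "\<forall>\<^sub>F y in at_right 0. 0 \<le> Re ((\<Sum>p\<le>n. \<Sum>i<p. of_real (b p) * S i y * cnj (S (p - Suc i) y)) + E y)"
    using eventually_at_right_less[of 0]
  proof eventually_elim
    case (elim y)
    have "z j y \<in> upper_half_plane" for j
      using elim by (simp add: z_def upper_half_plane_def)
    then have "0 \<le> Re (\<Sum>j<m. \<Sum>k<m. cnj (c j y) * c k y * K j k y)"
      unfolding K_def by (intro pick_kernel_nonneg[OF f]) auto
    then show ?case
      by (simp only: kernel[OF elim])
  qed
  ultimately have "0 \<le> Re ((\<Sum>p\<le>n. \<Sum>i<p. of_real (b p) * \<sigma> i * cnj (\<sigma> (p - Suc i))) + 0)"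
    by (rule tendsto_lowerbound) simp
  \<comment> \<open>Writing \<open>p\<close> as \<open>i + (p - Suc i) + 1\<close> makes the summand
    a function of the two indices of the square.\<close>
  also have "(\<Sum>p\<le>n. \<Sum>i<p. of_real (b p) * \<sigma> i * cnj (\<sigma> (p - Suc i))) =
      (\<Sum>p\<le>n. \<Sum>i<p. of_real (b (i + (p - Suc i) + 1)) * \<sigma> i * cnj (\<sigma> (p - Suc i)))"
    by (intro sum.cong refl) simp
  also have "\<dots> = (\<Sum>i<m. \<Sum>l<m. of_real (b (i + l + 1)) * \<sigma> i * cnj (\<sigma> l))"
    by (rule sum_antidiagonal_square) (auto simp: \<sigma>_def n)
  also have "\<dots> = (\<Sum>i<m. \<Sum>l<m. of_real (b (i + l + 1)) * v i * cnj (v l))"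
    by (simp add: \<sigma>_def)
  finally show ?thesis by simp
qed

section \<open>Rational solutions from a quadrature\<close>

lemma real_rational_on_uhp_const: "real_rational_on_uhp (\<lambda>z. of_real c)"
  unfolding real_rational_on_uhp_def
  by (intro exI[of _ "[:c:]"] exI[of _ "[:1:]"]) (simp add: poly_map_of_real_pCons)

lemma real_rational_on_uhp_add:
  assumes "real_rational_on_uhp f" "real_rational_on_uhp g"
  shows "real_rational_on_uhp (\<lambda>z. f z + g z)"
proof -
  obtain p q where f: "\<And>z. z \<in> upper_half_plane \<Longrightarrow> poly (map_poly of_real q) z \<noteq> 0 \<and>
      f z = poly (map_poly of_real p) z / poly (map_poly of_real q) z"
    using assms(1) unfolding real_rational_on_uhp_def by blast
  obtain p' q' where g: "\<And>z. z \<in> upper_half_plane \<Longrightarrow> poly (map_poly of_real q') z \<noteq> 0 \<and>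
      g z = poly (map_poly of_real p') z / poly (map_poly of_real q') z"
    using assms(2) unfolding real_rational_on_uhp_def by blast
  show ?thesis
    unfolding real_rational_on_uhp_def
    by (intro exI[of _ "p * q' + p' * q"] exI[of _ "q * q'"])
      (use f g in \<open>auto simp: map_poly_of_real_add map_poly_of_real_mult field_simps\<close>)
qed

lemma real_rational_on_uhp_sum:
  "(\<And>t. t \<in> T \<Longrightarrow> real_rational_on_uhp (f t)) \<Longrightarrow> real_rational_on_uhp (\<lambda>z. \<Sum>t\<in>T. f t z)"
  using real_rational_on_uhp_const[of 0]
  by (induction T rule: infinite_finite_induct) (auto intro: real_rational_on_uhp_add)

lemma rational_on_uhp_of_real_rational: "real_rational_on_uhp f \<Longrightarrow> rational_on_uhp f"
  unfolding real_rational_on_uhp_def rational_on_uhp_def by blast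

lemma denominator_nonzero:
  assumes "z \<in> upper_half_plane"
  shows "1 - of_real t * (z - of_real x) \<noteq> 0"
proof
  assume *: "1 - of_real t * (z - of_real x) = 0"
  then have "Im (1 - of_real t * (z - of_real x)) = 0" "Re (1 - of_real t * (z - of_real x)) = 0"
    by simp_all
  then show False
    using assms by (auto simp: upper_half_plane_def)
qed

text \<open>The geometric series; \<open>fps_X\<close> is the shift by which the \<open>j\<close>-th
  moment lands in the Taylor coefficient of order \<open>j + 1\<close>.\<close>

lemma fps_expansion_atom:
  "(\<lambda>z. z / (1 - of_real t * z)) has_fps_expansion
    fps_X * Abs_fps (\<lambda>j. complex_of_real t ^ j)"
proof -
  have "(\<lambda>z. z * inverse (1 - of_real t * z)) has_fps_expansion
      fps_X * inverse (1 - fps_const (complex_of_real t) * fps_X)"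
    by (intro fps_expansion_intros) auto
  moreover have "inverse (1 - fps_const (complex_of_real t) * fps_X) = Abs_fps (\<lambda>j. complex_of_real t ^ j)"
  proof (rule fps_inverse_unique)
    show "(1 - fps_const (complex_of_real t) * fps_X) * Abs_fps (\<lambda>j. complex_of_real t ^ j) = 1"
    proof (rule fps_ext)
      fix n
      show "fps_nth ((1 - fps_const (complex_of_real t) * fps_X) * Abs_fps (\<lambda>j. complex_of_real t ^ j)) n =
          fps_nth 1 n"
        unfolding left_diff_distrib mult.assoc by (cases n) simp_all
    qed
  qed
  ultimately show ?thesis
    by (simp add: divide_inverse)
qed

text \<open>For \<open>t \<noteq> 0\<close> the summand equals
  \<open>1 / (t^2 (\<lambda> - z)) - 1 / t\<close> with \<open>\<lambda> = x + 1 / t\<close>, up to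
  the weight: a Nevanlinna term whose pole is real and different from \<open>x\<close>. A node
  \<open>t = 0\<close> contributes a linear term.\<close>

lemma analytic_solution_of_quadrature:
  fixes a :: "nat \<Rightarrow> real"
  assumes T: "finite T" "\<And>t. t \<in> T \<Longrightarrow> 0 \<le> w t" and "0 < n"
    and moments: "\<And>j. Suc j < n \<Longrightarrow> a (Suc j) = (\<Sum>t\<in>T. w t * t ^ j)"
    and last: "(\<Sum>t\<in>T. w t * t ^ (n - 1)) \<le> a n"
  shows "\<exists>f. analytic_solution n x a f \<and> real_rational_on_uhp f"
proof -
  define F :: "complex \<Rightarrow> complex" where "F u = of_real (a 0) + (\<Sum>t\<in>T. of_real (w t) * (u / (1 - of_real t * u)))" for u
  define f where "f z = F (z - of_real x)" for z
  define U where "U = (\<Inter>t\<in>T. {z. 1 - complex_of_real t * (z - of_real x) \<noteq> 0})"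
  have "open U"
    unfolding U_def by (intro open_INT T(1) ballI open_Collect_neq continuous_intros)
  have "of_real x \<in> U"
    by (simp add: U_def)
  have hol: "f holomorphic_on U"
    unfolding f_def F_def by (intro holomorphic_intros) (auto simp: U_def)
  have uhp_U: "upper_half_plane \<subseteq> U"
    using denominator_nonzero by (auto simp: U_def)
  have "0 \<le> Im (f z)" if z: "z \<in> upper_half_plane" for z
  proof -
    have "0 \<le> Im (of_real (w t) * ((z - of_real x) / (1 - of_real t * (z - of_real x))))" if "t \<in> T" for t
    proof -
      define u where "u = z - of_real x"
      have "Im u > 0"
        using z by (simp add: u_def upper_half_plane_def)
      have "u / (1 - of_real t * u) = u * cnj (1 - of_real t * u) / of_real ((cmod (1 - of_real t * u))\<^sup>2)"
        by (subst complex_div_cnj) (simp only: of_real_power)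
      also have "Im \<dots> = Im (u * cnj (1 - of_real t * u)) / (cmod (1 - of_real t * u))\<^sup>2"
        by (rule Im_divide_of_real)
      \<comment> \<open>The product \<open>u * cnj (t * u)\<close> is real, so only \<open>u\<close>
        itself contributes.\<close>
      also have "Im (u * cnj (1 - of_real t * u)) = Im u"
        by (simp add: algebra_simps)
      finally have "0 \<le> Im (u / (1 - of_real t * u))"
        using \<open>Im u > 0\<close> by simp
      then have "0 \<le> w t * Im (u / (1 - of_real t * u))"
        using T(2)[OF that] by simp
      then show ?thesis
        unfolding u_def[symmetric] by (simp del: times_divide_eq_right)
    qed
    then show ?thesis
      by (simp add: f_def F_def sum_nonneg)
  qed
  then have pick: "f \<in> pick_class"
    using hol uhp_U by (auto simp: pick_class_def intro: holomorphic_on_subset)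
  have rational: "real_rational_on_uhp f"
    unfolding f_def F_def
  proof (intro real_rational_on_uhp_add real_rational_on_uhp_sum real_rational_on_uhp_const)
    fix t
    show "real_rational_on_uhp (\<lambda>z. of_real (w t) * ((z - of_real x) / (1 - of_real t * (z - of_real x))))"
      unfolding real_rational_on_uhp_def
    proof (intro exI ballI conjI)
      fix z assume "z \<in> upper_half_plane"
      then show "poly (map_poly of_real [:1 + t * x, - t:]) z \<noteq> 0"
        using denominator_nonzero[of z t x] by (simp add: poly_map_of_real_pCons algebra_simps)
      show "of_real (w t) * ((z - of_real x) / (1 - of_real t * (z - of_real x))) =
          poly (map_poly of_real [:- w t * x, w t:]) z / poly (map_poly of_real [:1 + t * x, - t:]) z"
        by (simp add: poly_map_of_real_pCons algebra_simps)
    qed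
  qed
  have F_fps: "F has_fps_expansion (fps_const (of_real (a 0)) +
      (\<Sum>t\<in>T. fps_const (of_real (w t)) * (fps_X * Abs_fps (\<lambda>j. complex_of_real t ^ j))))" (is "_ has_fps_expansion ?G")
    unfolding F_def by (intro fps_expansion_intros fps_expansion_atom)
  have f_coeff: "(deriv ^^ k) f (of_real x) / fact k = fps_nth ?G k" for k
  proof -
    have "(\<lambda>u. f (of_real x + u)) = F"
      by (simp add: f_def)
    then have "(deriv ^^ k) f (of_real x) = (deriv ^^ k) F 0"
      by (subst higher_deriv_shift_0) (simp add: o_def)
    then show ?thesis
      using fps_nth_fps_expansion[OF F_fps, of k] by simp
  qed
  have G_Suc: "fps_nth ?G (Suc j) = of_real (\<Sum>t\<in>T. w t * t ^ j)" for j
    by (simp add: fps_sum_nth)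
  have G_0: "fps_nth ?G 0 = of_real (a 0)"
    by (simp add: fps_sum_nth)
  have "analytic_solution n x a f"
    unfolding analytic_solution_def
  proof (intro conjI exI allI impI ballI)
    show "open U" "of_real x \<in> U" "f holomorphic_on U" by fact+
    show "f \<in> pick_class" by (rule pick)
    show "(deriv ^^ k) f (of_real x) / fact k = of_real (a k)" if "k < n" for k
      using that moments unfolding f_coeff by (cases k) (simp_all only: G_0 G_Suc)
    show "(deriv ^^ n) f (of_real x) / fact n = of_real (\<Sum>t\<in>T. w t * t ^ (n - 1))"
      unfolding f_coeff using G_Suc[of "n - 1"] \<open>0 < n\<close> by simp
    show "(\<Sum>t\<in>T. w t * t ^ (n - 1)) \<le> a n" by (rule last)
  qed simp
  then show ?thesis
    using rational by blast
qed

section \<open>Hankel matrices and the theorem\<close>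

lemma hankel_form:
  assumes "v \<in> carrier_vec m"
  shows "(hankel m a *\<^sub>v v) \<bullet>c v =
    (\<Sum>i<m. \<Sum>l<m. of_real (a (i + l + 1)) * vec_index v i * cnj (vec_index v l))"
proof -
  have "(hankel m a *\<^sub>v v) \<bullet>c v =
      (\<Sum>l<m. \<Sum>i<m. of_real (a (l + i + 1)) * vec_index v i * cnj (vec_index v l))"
    using assms
    by (simp add: hankel_def scalar_prod_def sum_distrib_right lessThan_atLeast0 conjugate_complex_def)
  also have "\<dots> = (\<Sum>l<m. \<Sum>i<m. of_real (a (i + l + 1)) * vec_index v i * cnj (vec_index v l))"
    by (simp add: add.commute)
  finally show ?thesis
    by (subst sum.swap)
qed

lemma adjoint_hankel: "mat_adjoint (hankel m a) = hankel m a"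
  by (rule eq_matI)
    (auto simp: hankel_def mat_adjoint_def mat_of_rows_def conjugate_complex_def add.commute)

text \<open>The form of a real symmetric matrix is real, which reduces the order on
  \<open>complex\<close> to the real part; functions replace vectors to avoid carrier
  conditions.\<close>

lemma positive_hankel_iff:
  "positive_mat (hankel m a) \<longleftrightarrow>
    (\<forall>v. 0 \<le> Re (\<Sum>i<m. \<Sum>l<m. of_real (a (i + l + 1)) * v i * cnj (v l)))"
proof -
  have "Im (\<Sum>i<m. \<Sum>l<m. of_real (a (i + l + 1)) * v i * cnj (v l)) = 0" for v
  proof -
    define S where "S = (\<Sum>i<m. \<Sum>l<m. complex_of_real (a (i + l + 1)) * v i * cnj (v l))"
    have "cnj S = S"
      unfolding S_def cnj_sum by (subst sum.swap) (simp add: add.commute mult_ac)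
    then have "Im (cnj S) = Im S"
      by simp
    then show ?thesis
      unfolding S_def[symmetric] by simp
  qed
  then have real: "0 \<le> (\<Sum>i<m. \<Sum>l<m. of_real (a (i + l + 1)) * v i * cnj (v l)) \<longleftrightarrow>
      0 \<le> Re (\<Sum>i<m. \<Sum>l<m. of_real (a (i + l + 1)) * v i * cnj (v l))" for v
    by (simp only: less_eq_complex_def) simp
  have dim: "dim_row (hankel m a) = m"
    by (simp add: hankel_def)
  show ?thesis
  proof
    assume pos: "positive_mat (hankel m a)"
    show "\<forall>v. 0 \<le> Re (\<Sum>i<m. \<Sum>l<m. of_real (a (i + l + 1)) * v i * cnj (v l))"
    proof
      fix v :: "nat \<Rightarrow> complex"
      have "0 \<le> (hankel m a *\<^sub>v vec m v) \<bullet>c vec m v"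
        using pos by (simp add: positive_mat_def dim)
      also have "\<dots> = (\<Sum>i<m. \<Sum>l<m. of_real (a (i + l + 1)) * v i * cnj (v l))"
        by (subst hankel_form) auto
      finally show "0 \<le> Re (\<Sum>i<m. \<Sum>l<m. of_real (a (i + l + 1)) * v i * cnj (v l))"
        by (simp only: real)
    qed
  next
    assume "\<forall>v. 0 \<le> Re (\<Sum>i<m. \<Sum>l<m. of_real (a (i + l + 1)) * v i * cnj (v l))"
    then show "positive_mat (hankel m a)"
      unfolding positive_mat_def dim by (auto simp only: adjoint_hankel hankel_form real)
  qed
qed

text \<open>The index \<open>n = 2 * k + 1\<close> occurs in the matrix only at
  \<open>i = l = k\<close>, so passing from \<open>c\<close> to \<open>a n\<close> adds
  \<open>(a n - c) * (cmod (v k))^2\<close> to the form, and \<open>c \<le> a n\<close> makes this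
  nonnegative.\<close>

lemma vertical_expansion_imp_positive_hankel:
  assumes "odd n" "f \<in> pick_class" "c \<le> a n" "vertical_expansion n x (a(n := c)) f"
  shows "positive_mat (hankel ((n + 1) div 2) a)"
  unfolding positive_hankel_iff
proof
  fix v :: "nat \<Rightarrow> complex"
  obtain k where k: "n = 2 * k + 1"
    using assms(1) by (rule oddE)
  define b where "b = a(n := c)"
  have m: "(n + 1) div 2 = Suc k"
    by (simp add: k)
  have "0 \<le> Re (\<Sum>i<Suc k. \<Sum>l<Suc k. of_real (b (i + l + 1)) * v i * cnj (v l))"
    using pick_hankel_form_nonneg[OF assms(2) _ _ assms(4), of "Suc k" v] by (simp only: b_def k) simp
  moreover have "Re (\<Sum>i<Suc k. \<Sum>l<Suc k. of_real (a (i + l + 1)) * v i * cnj (v l)) =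
      Re (\<Sum>i<Suc k. \<Sum>l<Suc k. of_real (b (i + l + 1)) * v i * cnj (v l)) + (a n - c) * (cmod (v k))\<^sup>2"
  proof -
    have "a (i + l + 1) = b (i + l + 1) + (if l = k then if i = k then a n - c else 0 else 0)"
      if "i < Suc k" "l < Suc k" for i l
      using that by (auto simp: b_def k mult_2)
    then have "(\<Sum>i<Suc k. \<Sum>l<Suc k. of_real (a (i + l + 1)) * v i * cnj (v l)) =
        (\<Sum>i<Suc k. \<Sum>l<Suc k. of_real (b (i + l + 1)) * v i * cnj (v l) +
          (if l = k then if i = k then of_real (a n - c) * v i * cnj (v l) else 0 else 0))"
      by (intro sum.cong refl) (auto simp: algebra_simps)
    also have "\<dots> = (\<Sum>i<Suc k. \<Sum>l<Suc k. of_real (b (i + l + 1)) * v i * cnj (v l))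
        + of_real (a n - c) * (v k * cnj (v k))"
      by (simp only: sum.distrib sum.delta finite_lessThan lessThan_iff lessI if_True mult.assoc)
    finally show ?thesis
      by (simp only: complex_norm_square[symmetric] plus_complex.sel of_real_mult[symmetric]
          of_real_power[symmetric] Re_complex_of_real)
  qed
  moreover have "0 \<le> (a n - c) * (cmod (v k))\<^sup>2"
    using assms(3) by simp
  ultimately show "0 \<le> Re (\<Sum>i<(n + 1) div 2. \<Sum>l<(n + 1) div 2. of_real (a (i + l + 1)) * v i * cnj (v l))"
    unfolding m by linarith
qed

lemma positive_hankel_imp_solution:
  assumes "odd n" "positive_mat (hankel ((n + 1) div 2) a)"
  shows "\<exists>f. analytic_solution n x a f \<and> real_rational_on_uhp f"
proof -
  define m where "m = (n + 1) div 2"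
  have m: "0 < m" "n = 2 * m - 1"
    using assms(1) by (auto simp: m_def elim!: oddE)
  define s where "s j = a (j + 1)" for j
  have psd: "0 \<le> moment s (q * q)" if "degree q < m" for q
  proof -
    have "moment s (q * q) = Re (\<Sum>i<m. \<Sum>l<m. of_real (a (i + l + 1)) * of_real (coeff q i) * cnj (of_real (coeff q l)))"
      using that by (simp add: moment_mult s_def mult_ac)
    also have "0 \<le> \<dots>"
      using assms(2) unfolding m_def[symmetric] positive_hankel_iff by (rule spec)
    finally show ?thesis .
  qed
  obtain T w where T: "finite T" "\<And>t. t \<in> T \<Longrightarrow> 0 \<le> w t"
    "\<And>j. j < 2 * m - 2 \<Longrightarrow> s j = (\<Sum>t\<in>T. w t * t ^ j)"
    "(\<Sum>t\<in>T. w t * t ^ (2 * m - 2)) \<le> s (2 * m - 2)"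
    using gauss_quadrature[OF psd m(1)] by blast
  show ?thesis
  proof (rule analytic_solution_of_quadrature[OF T(1,2)])
    show "a (Suc j) = (\<Sum>t\<in>T. w t * t ^ j)" if "Suc j < n" for j
      using T(3)[of j] that m by (simp add: s_def)
    have "2 * m - 2 = n - 1" "n - 1 + 1 = n"
      using m by auto
    then show "(\<Sum>t\<in>T. w t * t ^ (n - 1)) \<le> a n"
      using T(4) by (simp only: s_def)
  qed (use m in auto)
qed

theorem theorem4p1:
  fixes n :: nat and x :: real and a :: "nat \<Rightarrow> real"
  assumes "odd n"
  shows
    "((\<exists>f. weak_solution n x a f) \<longleftrightarrow> (\<exists>f. analytic_solution n x a f)) \<and>
     ((\<exists>f. analytic_solution n x a f) \<longleftrightarrow>
        (\<exists>f. analytic_solution n x a f \<and> rational_on_uhp f)) \<and>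
     ((\<exists>f. analytic_solution n x a f \<and> rational_on_uhp f) \<longleftrightarrow>
        (\<exists>f. analytic_solution n x a f \<and> real_rational_on_uhp f)) \<and>
     ((\<exists>f. analytic_solution n x a f \<and> real_rational_on_uhp f) \<longleftrightarrow>
        (\<exists>f. nt_solution n x a f)) \<and>
     ((\<exists>f. nt_solution n x a f) \<longleftrightarrow> (\<exists>f. radial_solution n x a f)) \<and>
     ((\<exists>f. radial_solution n x a f) \<longleftrightarrow> positive_mat (hankel ((n + 1) div 2) a))"
proof -
  have n: "0 < n"
    using assms by (rule odd_pos)
  have weak: "positive_mat (hankel ((n + 1) div 2) a)" if "weak_solution n x a f" for f
  proof -
    have "f \<in> pick_class"
      using that by (simp add: weak_solution_def)
    then show ?thesis
      using weak_solution_imp_vertical_expansion[OF that] vertical_expansion_imp_positive_hankel[OF assms]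
      by blast
  qed
  have radial: "positive_mat (hankel ((n + 1) div 2) a)" if "radial_solution n x a f" for f
  proof -
    have "f \<in> pick_class"
      using that by (simp add: radial_solution_def)
    then show ?thesis
      using radial_solution_imp_vertical_expansion[OF that n] vertical_expansion_imp_positive_hankel[OF assms]
      by blast
  qed
  \<comment> \<open>Every kind of solution leads to positivity through the weak or the radial
    notion, and positivity returns a real rational analytic solution, which is a solution of every
    kind.\<close>
  show ?thesis
    using weak radial positive_hankel_imp_solution[OF assms] analytic_solution_imp_weak_solution
      analytic_solution_imp_nt_solution nt_solution_imp_radial_solution rational_on_uhp_of_real_rational
    by blast
qed

end
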